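(* Suppose that there exists a family of measures $\{\pi^\wp_{z_1,z_2}\}_{z_1,z_2\in I}\subset\mathcal{P}(I)$ such that $$\psi_\eta(z_1)\,\psi_\eta(z_2)=\int_I\psi_\eta\,d\pi^\wp_{z_1,z_2}\qquad(z_1,z_2\in I,\ \eta\in\mathrm{supp}(\boldsymbol{\sigma})).$$ Then for each $\eta\in\mathrm{supp}(\boldsymbol{\sigma})$ and $\xi_1,\xi_2\in M$ there exists a positive measure $\boldsymbol{\gamma}^\wp_{\eta,\xi_1,\xi_2}$ on $M$ (not depending on $\lambda$) such that the product $w^\wp_{\lambda,\eta}(\xi_1)\,w^\wp_{\lambda,\eta}(\xi_2)$ admits the integral representation $$w^\wp_{\lambda,\eta}(\xi_1)\,w^\wp_{\lambda,\eta}(\xi_2)=\int_Mw^\wp_{\lambda,\eta}(\xi_3)\,\boldsymbol{\gamma}^\wp_{\eta,\xi_1,\xi_2}(d\xi_3),\qquad\xi_1,\xi_2\in M,\ \lambda\in\mathbb{C},\ \eta\in\mathrm{supp}(\boldsymbol{\sigma}).$$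
   Context: $\mathbb{R}^+=(0,\infty)$, $\mathbb{R}_0^+=[0,\infty)$; $\mathcal{P}(I)$ is the set of Borel probability measures on $I$. Assumptions on $A$: $A\in \mathrm{C}(\mathbb{R}_0^+)\cap \mathrm{C}^1(\mathbb{R}^+)$, $A(x)>0$ for $x>0$, $\int_0^1\frac{dx}{A(x)}<\infty$, $A'/A$ nonnegative and decreasing (not necessarily strictly), $\lim_{x\to\infty}A(x)=\infty$. On $(a,b)$, $-\infty\le a<b\le\infty$, let $\wp_z=\frac1{\mathfrak{r}(z)}\bigl(\mathfrak{p}(z)\partial_z^2+\mathfrak{p}'(z)\partial_z\bigr)$ with $\mathfrak{p},\mathfrak{r}>0$ locally absolutely continuous on $(a,b)$ and $a$ regular or entrance. Feller classification (independent of $c\in(a,b)$): let $I_a=\int_a^c\int_a^y\frac{dx}{\mathfrak{p}(x)}\mathfrak{r}(y)dy$, $J_a=\int_a^c\int_y^c\frac{dx}{\mathfrak{p}(x)}\mathfrak{r}(y)dy$, $I_b=\int_c^b\int_y^b\frac{dx}{\mathfrak{p}(x)}\mathfrak{r}(y)dy$, $J_b=\int_c^b\int_c^y\frac{dx}{\mathfrak{p}(x)}\mathfrak{r}(y)dy$. An endpoint $e$ is regular if $I_e,J_e<\infty$; exit if $I_e<\infty=J_e$; entrance if $J_e<\infty=I_e$; natural if $I_e=J_e=\infty$. Set $I=[a,b)$ if $b$ is exit or natural, $I=[a,b]$ if $b$ is regular or entrance; $M=\mathbb{R}_0^+\times I$, with points $\xi=(x,z)$. $\psi_\eta$ is the unique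 solution of $-\wp_zu=\eta u$ on $(a,b)$ with $u(a)=1$, $(\mathfrak{p}u')(a)=0$ (values at endpoints are limits). $\boldsymbol{\sigma}$ is the spectral measure of the Neumann realization of $-\wp$ in $L^2((a,b),\mathfrak{r}(z)dz)$ (domain: $u\in L^2(\mathfrak{r})$ with $u,u'\in\mathrm{AC}_{\mathrm{loc}}(a,b)$, $\wp u\in L^2(\mathfrak{r})$, $(\mathfrak{p}u')(a)=0$, and also $(\mathfrak{p}u')(b)=0$ if $b$ is regular or entrance), i.e. the locally finite positive Borel measure on $\mathbb{R}_0^+$ such that $g\mapsto\int_a^bg(z)\psi_\eta(z)\mathfrak{r}(z)dz$ is an isometric isomorphism of $L^2(\mathfrak{r})$ onto $L^2(\mathbb{R}_0^+,\boldsymbol{\sigma})$ with inverse $\varphi\mapsto\int_{\mathbb{R}_0^+}\varphi(\eta)\psi_\eta(z)\boldsymbol{\sigma}(d\eta)$, diagonalizing this operator as multiplication by $\eta$. For $(\lambda,\eta)\in\mathbb{C}\times\mathbb{R}_0^+$, $w^\wp_{\lambda,\eta}(x,z)=\psi_\eta(z)\,v_{\lambda,\eta}(x)$, where $v_{\lambda,\eta}$ is the unique solution, continuous on $\mathbb{R}_0^+$, of $-v''-\frac{A'}{A}v'+\frac{\eta}{A^2}v=\lambda v$ on $\mathbb{R}^+$ with $v(0)=1$, $\lim_{x\downarrow0}A(x)v'(x)=0$; it is the separable solution of $-\boldsymbol{\mathcal{G}}^\wp u=\lambda u$ for $\boldsymbol{\mathcal{G}}^\wp=\partial_x^2+\frac{A'}{A}\partial_x+\frac1{A^2}\wp_z$.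 *)

theory Defs
  imports "HOL-Probability.Probability_Measure"
begin

text \<open>
  Absolute continuity, with finite families of non-overlapping compact intervals
  given as divisions.
\<close>

definition abs_cont_on :: "real set \<Rightarrow> (real \<Rightarrow> 'a::real_normed_vector) \<Rightarrow> bool" where
  "abs_cont_on S f \<longleftrightarrow>
    (\<forall>\<epsilon>>0. \<exists>\<delta>>0. \<forall>D. D division_of \<Union>D \<and> \<Union>D \<subseteq> S \<and> (\<Sum>K\<in>D. measure lborel K) < \<delta> \<longrightarrow>
      (\<Sum>K\<in>D. norm (f (Sup K) - f (Inf K))) < \<epsilon>)"

definition loc_abs_cont :: "ereal \<Rightarrow> ereal \<Rightarrow> (real \<Rightarrow> 'a::real_normed_vector) \<Rightarrow> bool" where
  "loc_abs_cont a b f \<longleftrightarrow> (\<forall>c d. {c..d} \<subseteq> einterval a b \<longrightarrow> abs_cont_on {c..d} f)"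


subsection \<open>Feller classification of the endpoints\<close>

definition Feller_I_left :: "(real \<Rightarrow> real) \<Rightarrow> (real \<Rightarrow> real) \<Rightarrow> ereal \<Rightarrow> real \<Rightarrow> ennreal" where
  "Feller_I_left p r a c =
    (\<integral>\<^sup>+y\<in>einterval a c. (\<integral>\<^sup>+x\<in>einterval a y. ennreal (1 / p x) \<partial>lborel) * ennreal (r y) \<partial>lborel)"

definition Feller_J_left :: "(real \<Rightarrow> real) \<Rightarrow> (real \<Rightarrow> real) \<Rightarrow> ereal \<Rightarrow> real \<Rightarrow> ennreal" where
  "Feller_J_left p r a c =
    (\<integral>\<^sup>+y\<in>einterval a c. (\<integral>\<^sup>+x\<in>einterval y c. ennreal (1 / p x) \<partial>lborel) * ennreal (r y) \<partial>lborel)"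

definition Feller_I_right :: "(real \<Rightarrow> real) \<Rightarrow> (real \<Rightarrow> real) \<Rightarrow> ereal \<Rightarrow> real \<Rightarrow> ennreal" where
  "Feller_I_right p r b c =
    (\<integral>\<^sup>+y\<in>einterval c b. (\<integral>\<^sup>+x\<in>einterval y b. ennreal (1 / p x) \<partial>lborel) * ennreal (r y) \<partial>lborel)"

definition Feller_J_right :: "(real \<Rightarrow> real) \<Rightarrow> (real \<Rightarrow> real) \<Rightarrow> ereal \<Rightarrow> real \<Rightarrow> ennreal" where
  "Feller_J_right p r b c =
    (\<integral>\<^sup>+y\<in>einterval c b. (\<integral>\<^sup>+x\<in>einterval c y. ennreal (1 / p x) \<partial>lborel) * ennreal (r y) \<partial>lborel)"

text \<open>
  For positive coefficients that are continuous on the open interval from \<open>a\<close> to \<open>b\<close>, finiteness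
  of these integrals does not depend on the interior point \<open>c\<close>, so that the
  quantifier over \<open>c\<close> below could equally be existential.
\<close>

definition regular_left :: "(real \<Rightarrow> real) \<Rightarrow> (real \<Rightarrow> real) \<Rightarrow> ereal \<Rightarrow> ereal \<Rightarrow> bool" where
  "regular_left p r a b \<longleftrightarrow>
    (\<forall>c\<in>einterval a b. Feller_I_left p r a c < \<infinity> \<and> Feller_J_left p r a c < \<infinity>)"

definition entrance_left :: "(real \<Rightarrow> real) \<Rightarrow> (real \<Rightarrow> real) \<Rightarrow> ereal \<Rightarrow> ereal \<Rightarrow> bool" where
  "entrance_left p r a b \<longleftrightarrow>
    (\<forall>c\<in>einterval a b. Feller_J_left p r a c < \<infinity> \<and> Feller_I_left p r a c = \<infinity>)"

definition regular_right :: "(real \<Rightarrow> real) \<Rightarrow> (real \<Rightarrow> real) \<Rightarrow> ereal \<Rightarrow> ereal \<Rightarrow> bool" where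
  "regular_right p r a b \<longleftrightarrow>
    (\<forall>c\<in>einterval a b. Feller_I_right p r b c < \<infinity> \<and> Feller_J_right p r b c < \<infinity>)"

definition entrance_right :: "(real \<Rightarrow> real) \<Rightarrow> (real \<Rightarrow> real) \<Rightarrow> ereal \<Rightarrow> ereal \<Rightarrow> bool" where
  "entrance_right p r a b \<longleftrightarrow>
    (\<forall>c\<in>einterval a b. Feller_J_right p r b c < \<infinity> \<and> Feller_I_right p r b c = \<infinity>)"

text \<open>
  The four Feller types are exhaustive, so the second branch is the case in which \<open>b\<close> is
  exit or natural.  Endpoints may be infinite, hence the state space lives in \<open>ereal\<close>.
\<close>

definition state_interval ::
    "(real \<Rightarrow> real) \<Rightarrow> (real \<Rightarrow> real) \<Rightarrow> ereal \<Rightarrow> ereal \<Rightarrow> ereal set" where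
  "state_interval p r a b =
    (if regular_right p r a b \<or> entrance_right p r a b then {a..b} else {a..<b})"

definition state_space ::
    "(real \<Rightarrow> real) \<Rightarrow> (real \<Rightarrow> real) \<Rightarrow> ereal \<Rightarrow> ereal \<Rightarrow> (real \<times> ereal) set" where
  "state_space p r a b = {0..} \<times> state_interval p r a b"


subsection \<open>The Sturm-Liouville expression and its Neumann solutions\<close>

text \<open>
  As \<open>p\<close> and \<open>u'\<close> are only locally absolutely continuous, the expression \<open>(p u'' + p' u') / r\<close> is
  meaningful almost everywhere.
\<close>

definition SL_op ::
    "(real \<Rightarrow> real) \<Rightarrow> (real \<Rightarrow> real) \<Rightarrow> (real \<Rightarrow> 'a::real_normed_vector) \<Rightarrow> real \<Rightarrow> 'a" where
  "SL_op p r u z =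
    (1 / r z) *\<^sub>R
      (p z *\<^sub>R vector_derivative (\<lambda>y. vector_derivative u (at y)) (at z)
        + deriv p z *\<^sub>R vector_derivative u (at z))"

definition SL_regular :: "ereal \<Rightarrow> ereal \<Rightarrow> (real \<Rightarrow> 'a::real_normed_vector) \<Rightarrow> bool" where
  "SL_regular a b u \<longleftrightarrow>
    (\<forall>z\<in>einterval a b. u differentiable (at z)) \<and>
    loc_abs_cont a b u \<and> loc_abs_cont a b (\<lambda>z. vector_derivative u (at z))"

definition quasi_deriv :: "(real \<Rightarrow> real) \<Rightarrow> (real \<Rightarrow> 'a::real_normed_vector) \<Rightarrow> real \<Rightarrow> 'a" where
  "quasi_deriv p u z = p z *\<^sub>R vector_derivative u (at z)"

definition Neumann_solution ::
    "(real \<Rightarrow> real) \<Rightarrow> (real \<Rightarrow> real) \<Rightarrow> ereal \<Rightarrow> ereal \<Rightarrow> real \<Rightarrow> (real \<Rightarrow> real) \<Rightarrow> bool" where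
  "Neumann_solution p r a b \<eta> u \<longleftrightarrow>
    SL_regular a b u \<and>
    (AE z in lborel. z \<in> einterval a b \<longrightarrow> - SL_op p r u z = \<eta> * u z) \<and>
    ((u \<circ> real_of_ereal) \<longlongrightarrow> 1) (at_right a) \<and>
    ((quasi_deriv p u \<circ> real_of_ereal) \<longlongrightarrow> 0) (at_right a)"

definition endpoint_ext :: "ereal \<Rightarrow> ereal \<Rightarrow> (real \<Rightarrow> real) \<Rightarrow> ereal \<Rightarrow> real" where
  "endpoint_ext a b u z =
    (if z \<le> a then Lim (at_right a) (u \<circ> real_of_ereal)
     else if b \<le> z then Lim (at_left b) (u \<circ> real_of_ereal)
     else u (real_of_ereal z))"


subsection \<open>The spectral measure\<close>

definition L2 :: "'a measure \<Rightarrow> ('a \<Rightarrow> complex) set" where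
  "L2 N = {f \<in> borel_measurable N. integrable N (\<lambda>x. (norm (f x))\<^sup>2)}"

definition weight_measure :: "(real \<Rightarrow> real) \<Rightarrow> ereal \<Rightarrow> ereal \<Rightarrow> real measure" where
  "weight_measure r a b = density (restrict_space lborel (einterval a b)) (\<lambda>z. ennreal (r z))"

definition Neumann_domain ::
    "(real \<Rightarrow> real) \<Rightarrow> (real \<Rightarrow> real) \<Rightarrow> ereal \<Rightarrow> ereal \<Rightarrow> (real \<Rightarrow> complex) set" where
  "Neumann_domain p r a b =
    {u. u \<in> L2 (weight_measure r a b) \<and> SL_regular a b u \<and>
        SL_op p r u \<in> L2 (weight_measure r a b) \<and>
        ((quasi_deriv p u \<circ> real_of_ereal) \<longlongrightarrow> 0) (at_right a) \<and>
        (regular_right p r a b \<or> entrance_right p r a b \<longrightarrow>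
          ((quasi_deriv p u \<circ> real_of_ereal) \<longlongrightarrow> 0) (at_left b))}"

text \<open>
  For general square integrable functions the two integral transforms do not converge
  absolutely; they are limits in mean of the truncated integrals.  No truncation is
  needed at \<open>a\<close>, where \<open>r\<close> is integrable and \<open>\<psi> \<eta>\<close> is bounded.
  Both transforms are given as relations between representatives.
\<close>

definition SL_transform ::
    "(real \<Rightarrow> real) \<Rightarrow> ereal \<Rightarrow> ereal \<Rightarrow> (real \<Rightarrow> real \<Rightarrow> real) \<Rightarrow> real measure \<Rightarrow>
      (real \<Rightarrow> complex) \<Rightarrow> (real \<Rightarrow> complex) \<Rightarrow> bool" where
  "SL_transform r a b \<psi> \<sigma> g \<phi> \<longleftrightarrow>
    g \<in> L2 (weight_measure r a b) \<and> \<phi> \<in> L2 \<sigma> \<and>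
    ((\<lambda>\<beta>. \<integral>\<^sup>+\<eta>. ennreal ((norm (\<phi> \<eta> -
        (LINT z:einterval a \<beta>|weight_measure r a b. \<psi> \<eta> z *\<^sub>R g z)))\<^sup>2) \<partial>\<sigma>) \<longlongrightarrow> 0) (at_left b)"

definition SL_inverse_transform ::
    "(real \<Rightarrow> real) \<Rightarrow> ereal \<Rightarrow> ereal \<Rightarrow> (real \<Rightarrow> real \<Rightarrow> real) \<Rightarrow> real measure \<Rightarrow>
      (real \<Rightarrow> complex) \<Rightarrow> (real \<Rightarrow> complex) \<Rightarrow> bool" where
  "SL_inverse_transform r a b \<psi> \<sigma> \<phi> g \<longleftrightarrow>
    \<phi> \<in> L2 \<sigma> \<and> g \<in> L2 (weight_measure r a b) \<and>
    ((\<lambda>n. \<integral>\<^sup>+z. ennreal ((norm (g z -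
        (LINT \<eta>:{0..n}|\<sigma>. \<psi> \<eta> z *\<^sub>R \<phi> \<eta>)))\<^sup>2) \<partial>weight_measure r a b) \<longlongrightarrow> 0) at_top"

definition spectral_measure ::
    "(real \<Rightarrow> real) \<Rightarrow> (real \<Rightarrow> real) \<Rightarrow> ereal \<Rightarrow> ereal \<Rightarrow> (real \<Rightarrow> real \<Rightarrow> real) \<Rightarrow>
      real measure \<Rightarrow> bool" where
  "spectral_measure p r a b \<psi> \<sigma> \<longleftrightarrow>
    sets \<sigma> = sets (restrict_space borel {0..}) \<and>
    (\<forall>K\<subseteq>{0..}. compact K \<longrightarrow> emeasure \<sigma> K < \<infinity>) \<and>
    (\<forall>g\<in>L2 (weight_measure r a b). \<exists>\<phi>. SL_transform r a b \<psi> \<sigma> g \<phi>) \<and>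
    (\<forall>\<phi>\<in>L2 \<sigma>. \<exists>g. SL_inverse_transform r a b \<psi> \<sigma> \<phi> g) \<and>
    (\<forall>g \<phi>. SL_transform r a b \<psi> \<sigma> g \<phi> \<longleftrightarrow> SL_inverse_transform r a b \<psi> \<sigma> \<phi> g) \<and>
    (\<forall>g \<phi>. SL_transform r a b \<psi> \<sigma> g \<phi> \<longrightarrow>
      (\<integral>\<eta>. (norm (\<phi> \<eta>))\<^sup>2 \<partial>\<sigma>) = (\<integral>z. (norm (g z))\<^sup>2 \<partial>weight_measure r a b)) \<and>
    (\<forall>g \<phi>. SL_transform r a b \<psi> \<sigma> g \<phi> \<longrightarrow>
      ((\<exists>u\<in>Neumann_domain p r a b. AE z in weight_measure r a b. u z = g z) \<longleftrightarrow>
        (\<lambda>\<eta>. \<eta> *\<^sub>R \<phi> \<eta>) \<in> L2 \<sigma>)) \<and>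
    (\<forall>u\<in>Neumann_domain p r a b. \<forall>\<phi>. SL_transform r a b \<psi> \<sigma> u \<phi> \<longrightarrow>
      SL_transform r a b \<psi> \<sigma> (\<lambda>z. - SL_op p r u z) (\<lambda>\<eta>. \<eta> *\<^sub>R \<phi> \<eta>))"

definition msupport :: "'a::topological_space measure \<Rightarrow> 'a set" where
  "msupport N = {x \<in> space N. \<forall>U. open U \<and> x \<in> U \<longrightarrow> emeasure N (U \<inter> space N) > 0}"


subsection \<open>The cone-like operator and its separable solutions\<close>

definition cone_function :: "(real \<Rightarrow> real) \<Rightarrow> bool" where
  "cone_function A \<longleftrightarrow>
    continuous_on {0..} A \<and> A C1_differentiable_on {0<..} \<and>
    (\<forall>x>0. A x > 0) \<and>
    set_integrable lborel {0<..<1} (\<lambda>x. 1 / A x) \<and>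
    (\<forall>x>0. deriv A x / A x \<ge> 0) \<and>
    antimono_on {0<..} (\<lambda>x. deriv A x / A x) \<and>
    filterlim A at_top at_top"

definition radial_solution ::
    "(real \<Rightarrow> real) \<Rightarrow> complex \<Rightarrow> real \<Rightarrow> (real \<Rightarrow> complex) \<Rightarrow> bool" where
  "radial_solution A \<mu> \<eta> v \<longleftrightarrow>
    continuous_on {0..} v \<and> v 0 = 1 \<and>
    (\<exists>v' v''.
      (\<forall>x>0. (v has_vector_derivative v' x) (at x) \<and> (v' has_vector_derivative v'' x) (at x) \<and>
        - v'' x - (deriv A x / A x) *\<^sub>R v' x + (\<eta> / (A x)\<^sup>2) *\<^sub>R v x = \<mu> * v x) \<and>
      ((\<lambda>x. A x *\<^sub>R v' x) \<longlongrightarrow> 0) (at_right 0))"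

definition separable_solution ::
    "ereal \<Rightarrow> ereal \<Rightarrow> (real \<Rightarrow> real \<Rightarrow> real) \<Rightarrow> (complex \<Rightarrow> real \<Rightarrow> real \<Rightarrow> complex) \<Rightarrow>
      complex \<Rightarrow> real \<Rightarrow> real \<times> ereal \<Rightarrow> complex" where
  "separable_solution a b \<psi> v \<mu> \<eta> \<xi> =
    complex_of_real (endpoint_ext a b (\<psi> \<eta>) (snd \<xi>)) * v \<mu> \<eta> (fst \<xi>)"

end

theory Submission
  imports Defs "HOL-Probability.Helly_Selection"
begin

text \<open>
  The angular factor is covered by the measures \<open>\<pi>\<close>, so for fixed \<open>\<eta>\<close> one needs a positive
  product formula for the radial solutions: \<open>v \<mu> x * v \<mu> y = \<integral> v \<mu> d\<nu>\<close> with \<open>\<nu>\<close> independent of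
  \<open>\<mu>\<close>.  Discretise the radial equation in flux form on a grid of mesh \<open>h\<close>.  The discrete solutions
  are orthogonal polynomials in the spectral parameter, and a maximum principle for the discrete
  hyperbolic equation (in the spirit of Szwarc) shows that their linearization coefficients are
  nonnegative; this uses exactly that \<open>A\<close> is increasing and log-concave and that \<open>- \<eta> / A\<^sup>2\<close> is
  increasing.  As \<open>h\<close> tends to \<open>0\<close> the discrete solutions converge locally uniformly.  Weighting the
  linearization measures by the solution for \<open>\<mu> = 0\<close>, which is at least \<open>1\<close>, makes them probability
  measures on \<open>[0, x + y]\<close>, and a weak limit of these gives \<open>\<nu>\<close>.
\<close>

section \<open>Nonnegative linearization for log-concave chains\<close>

locale log_concave_chain =
  fixes b q :: "nat \<Rightarrow> real"
  assumes b0: "b 0 = 0"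
    and b_pos: "0 < b (Suc n)"
    and b_mono: "b n \<le> b (Suc n)"
    and b_log_concave: "b n * b (Suc (Suc n)) \<le> (b (Suc n))\<^sup>2"
    and q_mono: "mono q"
begin

section \<open>Weights of the chain and positivity for the discrete hyperbolic equation\<close>

definition w :: "nat \<Rightarrow> real" where "w n = b n + b (Suc n)"

lemma b_nonneg: "0 \<le> b n"
  by (cases n) (auto simp: b0 less_imp_le b_pos)

lemma w_pos: "0 < w n"
  using b_nonneg[of n] b_pos[of n] by (simp add: w_def)

text \<open>By log-concavity the quotients \<open>b (Suc n) / b n\<close> decrease; the
  cross-multiplied form also covers \<open>b 0 = 0\<close>.\<close>

lemma b_ratio: "j \<le> i \<Longrightarrow> b j * b (Suc i) \<le> b i * b (Suc j)"
proof (induction i rule: dec_induct)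
  case base
  show ?case by simp
next
  case (step i)
  have "b (Suc i) * (b j * b (Suc (Suc i))) \<le> b (Suc i) * (b (Suc i) * b (Suc j))"
  proof -
    have "b (Suc i) * (b j * b (Suc (Suc i))) = (b j * b (Suc i)) * b (Suc (Suc i))" by simp
    also have "\<dots> \<le> (b i * b (Suc j)) * b (Suc (Suc i))"
      by (intro mult_right_mono step.IH b_nonneg)
    also have "\<dots> = (b i * b (Suc (Suc i))) * b (Suc j)" by simp
    also have "\<dots> \<le> (b (Suc i))\<^sup>2 * b (Suc j)"
      by (intro mult_right_mono b_log_concave b_nonneg)
    finally show ?thesis by (simp add: power2_eq_square mult_ac)
  qed
  then show ?case using b_pos[of i] by simp
qed

text \<open>\<open>w\<close> is the total conductance at a vertex. The term \<open>b i * b j\<close>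
  cancels and leaves \<open>b i * b (Suc j) - b (Suc i) * b j\<close>, so the sign comes from
  log-concavity. In \<open>left_weight_nonneg\<close> the cancellation leaves
  \<open>b (Suc i) * b (Suc j) - b i * b j\<close>, and the sign comes from monotonicity.\<close>

lemma right_weight_nonneg: "j \<le> i \<Longrightarrow> 0 \<le> w j * b i - w i * b j"
  using b_ratio[of j i] by (simp add: w_def algebra_simps)

lemma left_weight_nonneg: "0 \<le> w j * b (Suc i) - w i * b j"
  using mult_mono[OF b_mono[of i] b_mono[of j]] b_nonneg by (simp add: w_def algebra_simps)

text \<open>
  Summing the equation over the characteristic triangle below \<open>(n, m + 1)\<close> expresses \<open>u n (m + 1)\<close>
  through the values of \<open>u\<close> on its two characteristic sides (weights \<open>c\<close>, \<open>d\<close> in the proof) and in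
  its interior (weight \<open>B\<close>), and all these weights are nonnegative.  In the proof \<open>T\<close> is the
  contribution of the interior of the triangle and \<open>V\<close> that of one characteristic line, so that
  no double sum is needed.
\<close>

lemma discrete_positivity:
  fixes u :: "nat \<Rightarrow> nat \<Rightarrow> real"
  assumes eq: "\<And>n m. w n * b (Suc m) * u n (Suc m) =
      w m * (b (Suc n) * u (Suc n) m + b n * u (n - 1) m)
      - w n * b m * u n (m - 1) + w n * w m * (q n - q m) * u n m"
    and init: "\<And>n. 0 \<le> u n 0"
  shows "m \<le> n \<Longrightarrow> 0 \<le> u n m"
proof (induction m arbitrary: n rule: less_induct)
  case (less m)
  define c where "c i j = (w j * b i - w i * b j) * u i j" for i j
  define d where "d i j = (w j * b (Suc i) - w i * b j) * u i j" for i j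
  define B where "B i j = w i * w j * (q i - q j) * u i j" for i j
  define T where "T i j = w i * b j * u i j - (\<Sum>l<j. c (i + j - l) l) - (\<Sum>l<j. d (i - j + l) l)" for i j
  have T0: "T i 0 = 0" for i by (simp add: T_def b0)
  have T1: "T (Suc i) (Suc 0) = B (Suc i) 0" for i
    using eq[of "Suc i" 0] by (simp add: T_def c_def d_def B_def b0 algebra_simps)
  \<comment> \<open>Inclusion-exclusion: the triangle below (i + 1, j + 2) is the union of those
    below (i + 2, j + 1) and (i, j + 1), which overlap in the one below (i + 1, j), together with
    the single point (i + 1, j + 1).\<close>
  have Trec: "T (Suc i) (Suc (Suc j)) =
      T (Suc (Suc i)) (Suc j) + T i (Suc j) - T (Suc i) j + B (Suc i) (Suc j)" if ji: "Suc j \<le> i" for i j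
  proof -
    \<comment> \<open>This form of \<open>i\<close> makes the truncated differences inside
      \<open>T\<close> exact.\<close>
    obtain k where k: "i = Suc j + k" using le_Suc_ex[OF ji] by blast
    define R where "R s n = (\<Sum>l<n. c (s - l) l)" for s n
    define L where "L s n = (\<Sum>l<n. d (s + l) l)" for s n
    define U where "U x y = w x * b y * u x y" for x y
    have Ts: "T (Suc i) (Suc (Suc j)) = U (Suc i) (Suc (Suc j))
          - (R (i + j + 3) (Suc j) + c (Suc (Suc i)) (Suc j)) - (L k (Suc j) + d i (Suc j))"
      "T (Suc (Suc i)) (Suc j) = U (Suc (Suc i)) (Suc j)
          - R (i + j + 3) (Suc j) - (L (Suc (Suc k)) j + d (Suc i) j)"
      "T i (Suc j) = U i (Suc j) - (R (i + j + 1) j + c (Suc i) j) - L k (Suc j)"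
      "T (Suc i) j = U (Suc i) j - R (i + j + 1) j - L (Suc (Suc k)) j"
      by (simp_all add: T_def R_def L_def U_def k numeral_3_eq_3 add.commute add.left_commute)
    have U: "U (Suc i) (Suc (Suc j)) =
        w (Suc j) * (b (Suc (Suc i)) * u (Suc (Suc i)) (Suc j) + b (Suc i) * u i (Suc j))
        - w (Suc i) * b (Suc j) * u (Suc i) j + B (Suc i) (Suc j)"
      using eq[of "Suc i" "Suc j"] by (simp add: U_def B_def)
    show ?thesis
      unfolding Ts U by (simp add: U_def c_def d_def w_def algebra_simps)
  qed
  \<comment> \<open>\<open>V i j\<close> adds up \<open>B\<close> along the line from (i, j) down
    through (i - 1, j - 1). On that line the first index exceeds the second, so
    \<open>q_mono\<close> and the outer induction make every term nonnegative.\<close>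
  define V where "V i j = T i (Suc j) - T (Suc i) j" for i j
  have V: "0 \<le> V i j" if "j < m" "j < i" for i j
    using that
  proof (induction j arbitrary: i)
    case 0
    then obtain i' where i: "i = Suc i'" by (cases i) auto
    show ?case using 0 less.IH[of 0 i] monoD[OF q_mono, of 0 i] w_pos
      by (simp add: V_def T0 i T1 B_def less_imp_le)
  next
    case (Suc j)
    then obtain i' where i: "i = Suc i'" by (cases i) auto
    have "0 \<le> B i (Suc j)"
      using Suc.prems less.IH[of "Suc j" i] monoD[OF q_mono, of "Suc j" i] w_pos
      by (simp add: B_def less_imp_le)
    moreover have "V i (Suc j) = V i' j + B i (Suc j)"
      using Trec[of j i'] Suc.prems by (simp add: V_def i)
    ultimately show ?case using Suc.IH[of i'] Suc.prems by (simp add: i)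
  qed
  have T: "0 \<le> T i j" if "j \<le> m" "j \<le> i" for i j
    using that
  proof (induction j arbitrary: i)
    case (Suc j)
    then have "0 \<le> T (Suc i) j" "0 \<le> V i j"
      using V[of j i] Suc.IH[of "Suc i"] by simp_all
    then show ?case by (simp add: V_def)
  qed (simp add: T0)
  show ?case
  proof (cases m)
    case 0
    then show ?thesis using init by simp
  next
    case (Suc m')
    \<comment> \<open>On both sides of the triangle below (n, m) the second index is smaller than m
      and at most the first, so the outer induction applies.\<close>
    have "0 \<le> (\<Sum>l<m. c (n + m - l) l)" "0 \<le> (\<Sum>l<m. d (n - m + l) l)"
      unfolding c_def d_def
      by (intro sum_nonneg mult_nonneg_nonneg right_weight_nonneg left_weight_nonneg less.IH;
          use less.prems in force)+
    then have "0 \<le> w n * b m * u n m"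
      using T[of m n] less.prems by (simp add: T_def)
    moreover have "0 < w n * b m" using w_pos b_pos[of m'] Suc by simp
    ultimately show ?thesis by (simp add: zero_le_mult_iff)
  qed
qed

section \<open>Orthogonal polynomials of the chain and their linearization\<close>

text \<open>
  At \<open>n = 0\<close> the truncated index \<open>n - 1\<close> is harmless, here and below, because \<open>b 0 = 0\<close>.
\<close>

fun P :: "'a::real_normed_field \<Rightarrow> nat \<Rightarrow> 'a" where
  "P s 0 = 1"
| "P s (Suc n) =
    (of_real (w n) * (s - of_real (q n)) * P s n - of_real (b n) * P s (n - 1)) / of_real (b (Suc n))"

lemma P_recurrence:
  "of_real (w n) * s * P s n =
    of_real (b (Suc n)) * P s (Suc n) + of_real (b n) * P s (n - 1) + of_real (w n * q n) * P s n"
  using b_pos[of n] by (simp add: field_simps)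

text \<open>The coefficient of \<open>P s k\<close> in \<open>P s n * P s m\<close>. As a function
  of (n, m) it must solve the equation that equates the action of the recurrence operator in n with
  its action in m; the recursion is this equation solved for row m + 1, and row 0 expresses
  \<open>P s n * P s 0 = P s n\<close>.\<close>

fun lin_coeff :: "nat \<Rightarrow> nat \<Rightarrow> nat \<Rightarrow> real" where
  "lin_coeff k 0 n = (if n = k then 1 else 0)"
| "lin_coeff k (Suc m) n =
    (w m * (b (Suc n) * lin_coeff k m (Suc n) + b n * lin_coeff k m (n - 1))
      - w n * b m * lin_coeff k (m - 1) n + w n * w m * (q n - q m) * lin_coeff k m n)
    / (w n * b (Suc m))"

lemma lin_coeff_recurrence:
  "w n * b (Suc m) * lin_coeff k (Suc m) n =
    w m * (b (Suc n) * lin_coeff k m (Suc n) + b n * lin_coeff k m (n - 1))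
    - w n * b m * lin_coeff k (m - 1) n + w n * w m * (q n - q m) * lin_coeff k m n"
  using w_pos[of n] b_pos[of m] by simp

lemma lin_coeff_nonneg: "m \<le> n \<Longrightarrow> 0 \<le> lin_coeff k m n"
  by (rule discrete_positivity[of "\<lambda>n m. lin_coeff k m n", OF lin_coeff_recurrence]) auto

text \<open>Inserting the induction hypothesis into the recursion for the coefficients, the
  recurrence in n collapses the terms to \<open>s * P s n * P s l\<close>, and the recurrence in l
  then isolates \<open>P s n * P s (Suc l)\<close>. A free bound \<open>N\<close> gives all the
  products involved the same range of summation.\<close>

lemma linearization:
  assumes "n + m \<le> N"
  shows "P s n * P s m = (\<Sum>k\<le>N. of_real (lin_coeff k m n) * P s k)"
  using assms
proof (induction m arbitrary: n rule: less_induct)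
  case (less m)
  show ?case
  proof (cases m)
    case 0
    have "(\<Sum>k\<le>N. of_real (lin_coeff k 0 n) * P s k) = (\<Sum>k\<le>N. if k = n then P s n else 0)"
      by (intro sum.cong) auto
    then show ?thesis using less.prems 0 by simp
  next
    case (Suc l)
    define S where "S i j = (\<Sum>k\<le>N. of_real (lin_coeff k i j) * P s k)" for i j
    have S1: "S l (Suc n) = P s (Suc n) * P s l" "S l n = P s n * P s l"
      using less.IH[of l "Suc n"] less.IH[of l n] less.prems Suc by (auto simp: S_def)
    have S2: "of_real (b n) * S l (n - 1) = of_real (b n) * (P s (n - 1) * P s l)"
      using less.IH[of l "n - 1"] less.prems Suc by (auto simp: S_def)
    have S3: "of_real (b l) * S (l - 1) n = of_real (b l) * (P s n * P s (l - 1))"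
    proof (cases l)
      case 0
      then show ?thesis by (simp add: b0)
    next
      case (Suc l')
      then show ?thesis using less.IH[of "l - 1" n] less.prems \<open>m = Suc l\<close> by (auto simp: S_def)
    qed
    let ?r = "of_real :: real \<Rightarrow> 'a"
    have nz: "?r (w n * b (Suc l)) \<noteq> 0" using w_pos[of n] b_pos[of l] by simp
    have "?r (w n * b (Suc l)) * S (Suc l) n =
      ?r (w l) * (?r (b (Suc n)) * S l (Suc n) + ?r (b n) * S l (n - 1))
      - ?r (w n) * (?r (b l) * S (l - 1) n) + ?r (w n * w l * (q n - q l)) * S l n"
    proof -
      have X: "?r (w n * b (Suc l)) * ?r (lin_coeff k (Suc l) n) =
        ?r (w l) * (?r (b (Suc n)) * ?r (lin_coeff k l (Suc n)) + ?r (b n) * ?r (lin_coeff k l (n - 1)))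
      - ?r (w n) * (?r (b l) * ?r (lin_coeff k (l - 1) n)) + ?r (w n * w l * (q n - q l)) * ?r (lin_coeff k l n)" for k
        using arg_cong[OF lin_coeff_recurrence[of n l k], of ?r] by (simp add: mult.assoc del: lin_coeff.simps)
      have "?r (w n * b (Suc l)) * (?r (lin_coeff k (Suc l) n) * P s k) =
        ?r (w l) * (?r (b (Suc n)) * (?r (lin_coeff k l (Suc n)) * P s k) + ?r (b n) * (?r (lin_coeff k l (n - 1)) * P s k))
      - ?r (w n) * (?r (b l) * (?r (lin_coeff k (l - 1) n) * P s k)) + ?r (w n * w l * (q n - q l)) * (?r (lin_coeff k l n) * P s k)" for k
        using arg_cong[OF X[of k], of "\<lambda>x. x * P s k"]
        by (simp only: distrib_right left_diff_distrib mult.assoc)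
      then show ?thesis
        by (simp only: S_def sum_distrib_left flip: sum.distrib sum_subtractf)
    qed
    also have "\<dots> = ?r (w l) * P s l * (?r (b (Suc n)) * P s (Suc n) + ?r (b n) * P s (n - 1) + ?r (w n * q n) * P s n)
        - ?r (w n) * P s n * (?r (b l) * P s (l - 1) + ?r (w l * q l) * P s l)"
      unfolding S1 S2 S3 by (simp add: algebra_simps del: P.simps)
    also have "\<dots> = ?r (w l) * P s l * (?r (w n) * s * P s n)
        - ?r (w n) * P s n * (?r (w l) * s * P s l - ?r (b (Suc l)) * P s (Suc l))"
      by (simp only: P_recurrence) (simp add: algebra_simps del: P.simps)
    also have "\<dots> = ?r (w n * b (Suc l)) * (P s n * P s (Suc l))"
      by (simp add: algebra_simps del: P.simps)
    finally show ?thesis using nz Suc by (simp add: S_def del: P.simps lin_coeff.simps of_real_mult)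
  qed
qed

lemma P_of_real: "P (of_real s :: 'a::real_normed_field) n = of_real (P s n)"
proof (induction n rule: less_induct)
  case (less n)
  then show ?case by (cases n) auto
qed

text \<open>At s = 1 the recurrence reads \<open>b (Suc n) * (P 1 (Suc n) - P 1 n) = b n * (P 1 n -
  P 1 (n - 1)) - w n * q n * P 1 n\<close>. For nonpositive \<open>q\<close> the increments
  therefore stay nonnegative, and the induction carries monotonicity along with the bound.\<close>

lemma P_one_ge_1:
  assumes "\<And>n. q n \<le> 0"
  shows "1 \<le> P (1::real) n"
proof -
  have "1 \<le> P (1::real) n \<and> P (1::real) n \<le> P 1 (Suc n)"
  proof (induction n)
    case 0
    have "b (Suc 0) \<le> b (Suc 0) * (1 - q 0)" using b_pos[of 0] assms[of 0] by simp
    then show ?case using b_pos[of 0] by (simp add: w_def b0 assms)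
  next
    case (Suc n)
    have "w (Suc n) * P 1 (Suc n) = b (Suc (Suc n)) * P 1 (Suc (Suc n)) + b (Suc n) * P 1 n
        + w (Suc n) * q (Suc n) * P 1 (Suc n)"
      using P_recurrence[of "Suc n" "1::real"] by (simp del: P.simps)
    moreover have "w (Suc n) * q (Suc n) * P 1 (Suc n) \<le> 0"
      using assms[of "Suc n"] w_pos[of "Suc n"] Suc by (simp add: mult_nonneg_nonpos mult_nonpos_nonneg del: P.simps)
    moreover have "b (Suc n) * P 1 n \<le> b (Suc n) * P 1 (Suc n)"
      using Suc b_pos[of n] by (simp del: P.simps)
    ultimately have "b (Suc (Suc n)) * P 1 (Suc n) \<le> b (Suc (Suc n)) * P 1 (Suc (Suc n))"
      by (simp add: w_def algebra_simps del: P.simps)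
    then show ?case using Suc b_pos[of "Suc n"] by (simp del: P.simps)
  qed
  then show ?thesis by simp
qed

end

section \<open>Discrete Gronwall inequality, meshes and weak limits\<close>

text \<open>The errors advance in turn, first \<open>c\<close> from the old \<open>a\<close>, then
  \<open>a\<close> from the new \<open>c\<close>, as flux and value do in
  \<open>approx_error\<close>. One step multiplies the total, defects included, by at most (1 + x)(1
  + y), hence by at most exp (x + y).\<close>

lemma discrete_gronwall:
  fixes a c x y r t :: "nat \<Rightarrow> real"
  assumes init: "a 0 = 0" "c 0 = 0"
    and nonneg: "\<And>k. 0 \<le> a k" "\<And>k. 0 \<le> c k" "\<And>k. 0 \<le> x k" "\<And>k. 0 \<le> y k" "\<And>k. 0 \<le> r k" "\<And>k. 0 \<le> t k"
    and c_step: "\<And>k. k < n \<Longrightarrow> c (Suc k) \<le> c k + y k * a k + t k"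
    and a_step: "\<And>k. k < n \<Longrightarrow> a (Suc k) \<le> a k + x k * c (Suc k) + r k"
  shows "a n + c n \<le> exp (\<Sum>k<n. x k + y k) * (\<Sum>k<n. r k + t k)"
  using c_step a_step
proof (induction n)
  case (Suc n)
  note nn = nonneg(1)[of n] nonneg(2)[of n] nonneg(3)[of n] nonneg(4)[of n] nonneg(5)[of n] nonneg(6)[of n]
  let ?z = "a n + c n + (r n + t n)"
  let ?e = "exp (\<Sum>k<n. x k + y k)"
  have "a (Suc n) + c (Suc n) \<le> a n + r n + (1 + x n) * c (Suc n)"
    using Suc.prems(2)[of n] by (simp add: algebra_simps)
  also have "\<dots> \<le> a n + r n + (1 + x n) * (c n + y n * a n + t n)"
    using nn by (intro add_left_mono mult_left_mono Suc.prems) auto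
  also have "\<dots> \<le> (1 + x n) * (1 + y n) * ?z"
  proof -
    have "0 \<le> x n * (a n + r n) + (1 + x n) * y n * (c n + r n + t n)"
      using nn by (intro add_nonneg_nonneg mult_nonneg_nonneg) auto
    then show ?thesis by (simp add: algebra_simps)
  qed
  also have "\<dots> \<le> (exp (x n) * exp (y n)) * ?z"
    using nn by (intro mult_right_mono mult_mono exp_ge_add_one_self) auto
  also have "\<dots> \<le> exp (x n + y n) * (?e * (\<Sum>k<n. r k + t k) + ?e * (r n + t n))"
    unfolding exp_add[symmetric]
  proof (intro mult_left_mono add_mono)
    show "a n + c n \<le> ?e * (\<Sum>k<n. r k + t k)" using Suc by simp
    have "1 \<le> ?e" using nonneg by (simp add: sum_nonneg)
    then show "r n + t n \<le> ?e * (r n + t n)"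
      using nn mult_right_mono[of 1 ?e "r n + t n"] by simp
  qed auto
  also have "\<dots> = exp (\<Sum>k<Suc n. x k + y k) * (\<Sum>k<Suc n. r k + t k)"
    by (simp add: exp_add algebra_simps)
  finally show ?case .
qed (simp add: init)

section \<open>Mesh sizes, nodes approaching a point, and weak limits of discrete
  distributions\<close>

definition mesh :: "nat \<Rightarrow> real" where "mesh j = 1 / real (Suc j)"

definition index :: "real \<Rightarrow> nat \<Rightarrow> nat" where "index x j = nat \<lfloor>x / mesh j\<rfloor>"

lemma mesh_pos: "0 < mesh j" by (simp add: mesh_def)

lemma mesh_limit: "filterlim mesh (at_right 0) sequentially"
  unfolding filterlim_at mesh_def[abs_def] using LIMSEQ_Suc[OF lim_1_over_n] by simp

lemma index_bounds:
  assumes "0 \<le> x"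
  shows "real (index x j) * mesh j \<le> x" "x \<le> real (index x j) * mesh j + mesh j"
proof -
  have "real (index x j) \<le> x / mesh j" "x / mesh j \<le> real (index x j) + 1"
    using assms mesh_pos[of j] by (auto simp: index_def divide_nonneg_pos)
  then show "real (index x j) * mesh j \<le> x" "x \<le> real (index x j) * mesh j + mesh j"
    using mesh_pos[of j] by (auto simp: field_simps)
qed

lemma index_limit:
  assumes "0 \<le> x"
  shows "(\<lambda>j. real (index x j) * mesh j) \<longlonglongrightarrow> x"
proof (rule tendsto_sandwich)
  have "mesh \<longlonglongrightarrow> 0" using mesh_limit by (simp add: filterlim_at)
  then show "(\<lambda>j. x - mesh j) \<longlonglongrightarrow> x"
    using tendsto_diff[of "\<lambda>_. x" x sequentially mesh 0] by simp
  show "\<forall>\<^sub>F j in sequentially. x - mesh j \<le> real (index x j) * mesh j"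
    using index_bounds(2)[OF assms] by (auto simp: algebra_simps)
  show "\<forall>\<^sub>F j in sequentially. real (index x j) * mesh j \<le> x"
    using index_bounds(1)[OF assms] by auto
qed auto

lemma index_mono: "x \<le> y \<Longrightarrow> index x j \<le> index y j"
  using mesh_pos[of j] by (auto simp: index_def intro!: nat_mono floor_mono divide_right_mono)

text \<open>All the distributions live on one compact interval, so they are tight and Helly
  selection applies. The subsequence is chosen before the test function.\<close>

lemma discrete_weak_limit:
  fixes p t :: "nat \<Rightarrow> nat \<Rightarrow> real" and N :: "nat \<Rightarrow> nat"
  assumes p_nonneg: "\<And>j k. 0 \<le> p j k" and p_sum: "\<And>j. (\<Sum>k\<le>N j. p j k) = 1"
    and t: "\<And>j k. k \<le> N j \<Longrightarrow> t j k \<in> {0..X}"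
  shows "\<exists>M s. real_distribution M \<and> strict_mono (s :: nat \<Rightarrow> nat) \<and>
    (\<forall>(f :: real \<Rightarrow> complex) B. (\<forall>x. isCont f x) \<longrightarrow> (\<forall>x. norm (f x) \<le> B) \<longrightarrow>
      (\<lambda>j. \<Sum>k\<le>N (s j). of_real (p (s j) k) * f (t (s j) k)) \<longlonglongrightarrow> integral\<^sup>L M f)"
proof -
  \<comment> \<open>Nodes may coincide, so the weights are first put on the indices and then
    transported by \<open>t j\<close>.\<close>
  define Q where "Q j = point_measure {..N j} (\<lambda>k. ennreal (p j k))" for j
  define D where "D j = distr (Q j) borel (t j)" for j
  have meas: "g \<in> measurable (Q j) L" if "g \<in> space (Q j) \<rightarrow> space L" for g j and L :: "'b measure"
    using that by (simp add: Q_def measurable_point_measure_eq1 space_point_measure)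
  have tm: "t j \<in> borel_measurable (Q j)" for j
    by (rule meas) auto
  have Qp: "prob_space (Q j)" for j
  proof
    have "emeasure (Q j) (space (Q j)) = (\<Sum>k\<le>N j. ennreal (p j k))"
      by (simp add: Q_def space_point_measure emeasure_point_measure_finite)
    then show "emeasure (Q j) (space (Q j)) = 1"
      using p_sum p_nonneg by simp
  qed
  have D: "real_distribution (D j)" for j
    unfolding D_def by (intro prob_space.real_distribution_distr Qp tm)
  have int: "integral\<^sup>L (D j) f = (\<Sum>k\<le>N j. of_real (p j k) * f (t j k))"
    if f: "f \<in> borel_measurable borel" for f :: "real \<Rightarrow> complex" and j
  proof -
    have "integral\<^sup>L (D j) f = (\<integral>k. f (t j k) \<partial>Q j)"
      unfolding D_def by (rule integral_distr[OF tm f])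
    also have "\<dots> = (\<Sum>k\<le>N j. p j k *\<^sub>R f (t j k))"
      unfolding Q_def using p_nonneg by (intro lebesgue_integral_point_measure_finite) auto
    finally show ?thesis by (simp add: scaleR_conv_of_real)
  qed
  have "tight D"
    unfolding tight_def
  proof (intro conjI allI impI D)
    fix \<epsilon> :: real assume "0 < \<epsilon>"
    \<comment> \<open>Tightness asks for half-open intervals, so the left end lies strictly below
      the possible node 0.\<close>
    have "measure (D j) {-1<..max X 0} = 1" for j
    proof -
      have "measure (D j) {-1<..max X 0} = measure (Q j) (t j -` {-1<..max X 0} \<inter> space (Q j))"
        unfolding D_def by (rule measure_distr[OF tm]) auto
      also have "t j -` {-1<..max X 0} \<inter> space (Q j) = space (Q j)"
        using t by (force simp: Q_def space_point_measure)
      finally show ?thesis using prob_space.prob_space[OF Qp] by simp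
    qed
    then show "\<exists>a b. a < b \<and> (\<forall>n. 1 - \<epsilon> < measure (D n) {a<..b})"
      using \<open>0 < \<epsilon>\<close> by (intro exI[of _ "-1"] exI[of _ "max X 0"]) auto
  qed
  then obtain s M where s: "strict_mono s" and M: "real_distribution M"
    and w: "weak_conv_m (D \<circ> id \<circ> s) M"
    using tight_imp_convergent_subsubsequence[of D id] strict_mono_id by (auto simp: id_def)
  have "(\<lambda>j. \<Sum>k\<le>N (s j). of_real (p (s j) k) * f (t (s j) k)) \<longlonglongrightarrow> integral\<^sup>L M f"
    if "\<And>x. isCont f x" "\<And>x. norm (f x) \<le> B" for f :: "real \<Rightarrow> complex" and B
  proof -
    interpret M: real_distribution M by (rule M)
    have "(\<lambda>j. integral\<^sup>L ((D \<circ> id \<circ> s) j) f) \<longlonglongrightarrow> integral\<^sup>L M f"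
      using D by (intro weak_conv_imp_integral_bdd_continuous_conv[OF _ M w that]) simp
    moreover have "f \<in> borel_measurable borel"
      using that(1) by (intro borel_measurable_continuous_onI continuous_at_imp_continuous_on) auto
    ultimately show ?thesis by (simp add: int)
  qed
  then show ?thesis using M s by blast
qed

section \<open>The radial equation\<close>

lemma integral_primitive_deriv:
  fixes f :: "real \<Rightarrow> real"
  assumes "\<And>y. f integrable_on {0..y}" "0 < x" "isCont f x"
  shows "((\<lambda>x. integral {0..x} f) has_real_derivative f x) (at x)"
proof -
  have "at x within {0..x + 1} = at x"
    using assms(2) by (intro at_within_interior) auto
  then show ?thesis
    using integral_has_vector_derivative_continuous_at[OF assms(1), of x "x + 1" "{}"] assms
    by (auto simp: has_real_derivative_iff_has_vector_derivative)
qed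

locale cone =
  fixes A :: "real \<Rightarrow> real"
  assumes cone: "cone_function A"
begin

section \<open>Monotonicity and log-concavity of \<open>A\<close>, and primitives of
  \<open>1 / A\<close> and \<open>A\<close>\<close>

lemma A_cont: "continuous_on {0..} A" and A_pos: "0 < x \<Longrightarrow> 0 < A x"
  using cone by (auto simp: cone_function_def)

lemma A_deriv: "0 < x \<Longrightarrow> (A has_real_derivative deriv A x) (at x)"
  using cone DERIV_deriv_iff_real_differentiable
  by (auto simp: cone_function_def C1_differentiable_on_eq)

lemma A_log_deriv_nonneg: "0 < x \<Longrightarrow> 0 \<le> deriv A x / A x"
  and A_log_deriv_antimono: "0 < x \<Longrightarrow> x \<le> y \<Longrightarrow> deriv A y / A y \<le> deriv A x / A x"
  using cone by (auto simp: cone_function_def monotone_on_def)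

lemma A_mono:
  assumes "0 \<le> x" "x \<le> y" shows "A x \<le> A y"
proof (rule DERIV_nonneg_imp_increasing_open[OF assms(2)])
  fix z assume z: "x < z" "z < y"
  then have "0 < z" using assms by simp
  then have "0 \<le> deriv A z"
    using A_log_deriv_nonneg[of z] A_pos[of z] by (simp add: zero_le_divide_iff)
  then show "\<exists>y. (A has_real_derivative y) (at z) \<and> 0 \<le> y"
    using A_deriv \<open>0 < z\<close> by blast
next
  show "continuous_on {x..y} A"
    using A_cont by (rule continuous_on_subset) (use assms in auto)
qed

lemma A_nonneg: "0 \<le> x \<Longrightarrow> 0 \<le> A x"
proof -
  have "0 \<le> A 0"
  proof (rule tendsto_lowerbound)
    show "(A \<longlongrightarrow> A 0) (at_right 0)"
      using A_cont[unfolded continuous_on_def] at_within_Ici_at_right[of "0::real"]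
      by (metis atLeast_iff order_refl)
    show "\<forall>\<^sub>F x in at_right 0. 0 \<le> A x"
      by (auto simp: eventually_at_filter less_imp_le A_pos)
  qed auto
  then show "0 \<le> x \<Longrightarrow> 0 \<le> A x" using A_mono[of 0 x] by simp
qed

text \<open>The mean value theorem for ln A on two adjacent intervals of length \<open>h\<close>
  compares two values of the decreasing function A' / A.\<close>

lemma A_log_concave:
  assumes "0 < x" "0 < h" shows "A x * A (x + 2 * h) \<le> (A (x + h))\<^sup>2"
proof -
  have D: "((\<lambda>x. ln (A x)) has_real_derivative deriv A t / A t) (at t)" if "0 < t" for t
    using that A_pos by (auto intro!: derivative_eq_intros A_deriv)
  obtain s where s: "x < s" "s < x + h" "ln (A (x + h)) - ln (A x) = h * (deriv A s / A s)"
    using MVT2[of x "x + h" "\<lambda>x. ln (A x)" "\<lambda>t. deriv A t / A t"] D assms by force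
  obtain t where t: "x + h < t" "t < x + 2 * h"
    "ln (A (x + 2 * h)) - ln (A (x + h)) = h * (deriv A t / A t)"
    using MVT2[of "x + h" "x + 2 * h" "\<lambda>x. ln (A x)" "\<lambda>t. deriv A t / A t"] D assms by force
  have "h * (deriv A t / A t) \<le> h * (deriv A s / A s)"
    using s t assms by (intro mult_left_mono A_log_deriv_antimono) auto
  then have "ln (A x) + ln (A (x + 2 * h)) \<le> 2 * ln (A (x + h))"
    using s t by linarith
  then have "ln (A x * A (x + 2 * h)) \<le> ln ((A (x + h))\<^sup>2)"
    using assms A_pos by (simp add: ln_mult_pos ln_realpow)
  moreover have "0 < A x" "0 < A (x + 2*h)" "0 < A (x + h)"
    using assms A_pos by auto
  ultimately show ?thesis by (simp del: ln_realpow)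
qed

text \<open>\<open>T\<close> is the scale function and \<open>S\<close> the speed function of the
  operator (A v')' / A. Integrability of 1 / A at 0 makes \<open>T\<close> continuous up to 0 even
  if \<open>A 0 = 0\<close>; local errors are measured in increments of \<open>T\<close> and
  \<open>S\<close>.\<close>

definition T :: "real \<Rightarrow> real" where "T x = integral {0..x} (\<lambda>t. 1 / A t)"
definition S :: "real \<Rightarrow> real" where "S x = integral {0..x} A"

lemma inverse_A_cont: "0 < c \<Longrightarrow> continuous_on {c..d} (\<lambda>t. 1 / A t)"
proof (intro continuous_intros continuous_on_subset[OF A_cont])
  assume "0 < c"
  then have "A t \<noteq> 0" if "t \<in> {c..d}" for t using that A_pos[of t] by auto
  then show "\<forall>t\<in>{c..d}. A t \<noteq> 0" by blast
qed auto

lemma inverse_A_integrable: "(\<lambda>t. 1 / A t) integrable_on {0..x}"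
proof -
  have "set_integrable lebesgue {0<..<1} (\<lambda>x. 1 / A x)"
    using cone by (auto simp: cone_function_def set_integrable_def integrable_completion)
  then have "(\<lambda>t. 1 / A t) integrable_on {0<..<1}"
    using set_lebesgue_integral_eq_integral(1) by blast
  then have 1: "(\<lambda>t. 1 / A t) integrable_on {0..1}"
    by (simp add: integrable_on_open_interval_real)
  have 2: "(\<lambda>t. 1 / A t) integrable_on {1..y}" for y
    by (intro integrable_continuous_interval inverse_A_cont) auto
  have "(\<lambda>t. 1 / A t) integrable_on {0..max 1 x}"
    by (rule Henstock_Kurzweil_Integration.integrable_combine[OF _ _ 1 2]) auto
  then show ?thesis by (rule integrable_on_subinterval) auto
qed

lemma A_integrable: "A integrable_on {0..x}"
  by (intro integrable_continuous_interval continuous_on_subset[OF A_cont]) auto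

lemma T_cont: "continuous_on {0..x} T" and S_cont: "continuous_on {0..x} S"
  unfolding T_def S_def
  by (intro indefinite_integral_continuous_1 inverse_A_integrable A_integrable)+

lemma T_0 [simp]: "T 0 = 0" and S_0 [simp]: "S 0 = 0"
  by (simp_all add: T_def S_def)

lemma A_isCont: "0 < x \<Longrightarrow> isCont A x"
  using A_deriv DERIV_isCont by blast

lemma T_deriv: "0 < x \<Longrightarrow> (T has_real_derivative 1 / A x) (at x)"
  unfolding T_def[abs_def] using A_pos[of x]
  by (intro integral_primitive_deriv inverse_A_integrable) (auto intro!: continuous_intros A_isCont)

lemma S_deriv: "0 < x \<Longrightarrow> (S has_real_derivative A x) (at x)"
  unfolding S_def[abs_def] by (intro integral_primitive_deriv A_integrable A_isCont)

text \<open>Mean value theorem and monotonicity of \<open>A\<close>. The upper bound asks for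
  \<open>0 < s\<close> because \<open>A 0\<close> may vanish.\<close>

lemma T_increment:
  assumes "0 \<le> s" "s < t"
  shows "(t - s) / A t \<le> T t - T s" "0 < s \<Longrightarrow> T t - T s \<le> (t - s) / A s"
proof -
  have "continuous_on {s..t} T"
    by (rule continuous_on_subset[OF T_cont[of t]]) (use assms in auto)
  then obtain z where z: "s < z" "z < t" "T t - T s = (t - s) * (1 / A z)"
    using MVT[OF assms(2), of T] T_deriv assms
    by (metis DERIV_unique order_le_less_trans real_differentiable_def)
  then have "1 / A t \<le> 1 / A z"
    using assms A_mono[of z t] A_pos[of z] by (intro divide_left_mono mult_pos_pos A_pos) auto
  then show "(t - s) / A t \<le> T t - T s"
    using z mult_left_mono[of "1 / A t" "1 / A z" "t - s"] assms by simp
  assume "0 < s"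
  then have "1 / A z \<le> 1 / A s"
    using z A_mono[of s z] by (intro divide_left_mono mult_pos_pos A_pos) auto
  then show "T t - T s \<le> (t - s) / A s"
    using z mult_left_mono[of "1 / A z" "1 / A s" "t - s"] assms by simp
qed

lemma S_increment:
  assumes "0 \<le> s" "s < t"
  shows "(t - s) * A s \<le> S t - S s" "S t - S s \<le> (t - s) * A t"
proof -
  have "continuous_on {s..t} S"
    by (rule continuous_on_subset[OF S_cont[of t]]) (use assms in auto)
  then obtain z where z: "s < z" "z < t" "S t - S s = (t - s) * A z"
    using MVT[OF assms(2), of S] S_deriv assms
    by (metis DERIV_unique order_le_less_trans real_differentiable_def)
  then show "(t - s) * A s \<le> S t - S s" "S t - S s \<le> (t - s) * A t"
    using assms A_mono[of s z] A_mono[of z t] by auto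
qed

lemma T_mono:
  assumes "0 \<le> s" "s \<le> t" shows "T s \<le> T t"
proof (cases "s = t")
  case False
  then have "0 \<le> (t - s) / A t" using assms A_nonneg[of t] by simp
  then show ?thesis using T_increment(1)[of s t] assms False by linarith
qed simp

lemma S_mono:
  assumes "0 \<le> s" "s \<le> t" shows "S s \<le> S t"
proof (cases "s = t")
  case False
  then have "0 \<le> (t - s) * A s" using assms A_nonneg[of s] by simp
  then show ?thesis using S_increment(1)[of s t] assms False by linarith
qed simp

text \<open>
  The flux \<open>G = A v'\<close> turns the equation into a first order system whose coefficients \<open>1 / A\<close> and
  \<open>\<eta> / A - \<mu> A\<close> are integrable at \<open>0\<close>.
\<close>

lemma radial_flux:
  assumes "radial_solution A \<mu> \<eta> v"
  obtains G where "continuous_on {0..} G" "G 0 = 0"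
    "\<And>x. 0 < x \<Longrightarrow> (v has_vector_derivative (1 / A x) *\<^sub>R G x) (at x)"
    "\<And>x. 0 < x \<Longrightarrow>
      (G has_vector_derivative (of_real (\<eta> / A x) - \<mu> * of_real (A x)) * v x) (at x)"
proof -
  obtain v' v'' where v':
      "\<And>x. 0 < x \<Longrightarrow> (v has_vector_derivative v' x) (at x)"
      "\<And>x. 0 < x \<Longrightarrow> (v' has_vector_derivative v'' x) (at x)"
      "\<And>x. 0 < x \<Longrightarrow> - v'' x - (deriv A x / A x) *\<^sub>R v' x + (\<eta> / (A x)\<^sup>2) *\<^sub>R v x = \<mu> * v x"
    and lim: "((\<lambda>x. A x *\<^sub>R v' x) \<longlongrightarrow> 0) (at_right 0)"
    using assms by (auto simp: radial_solution_def)
  \<comment> \<open>The value 0 at the origin is the limit given by the Neumann condition, so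
    \<open>G\<close> is continuous on the closed half-line.\<close>
  define G where "G x = (if x \<le> 0 then 0 else A x *\<^sub>R v' x)" for x
  have D: "(G has_vector_derivative (of_real (\<eta> / A x) - \<mu> * of_real (A x)) * v x) (at x)"
    if x: "0 < x" for x
  proof -
    have "((\<lambda>x. A x *\<^sub>R v' x) has_vector_derivative (A x *\<^sub>R v'' x + deriv A x *\<^sub>R v' x)) (at x)"
      using x by (intro has_vector_derivative_scaleR v' A_deriv)
    moreover have "A x *\<^sub>R v'' x + deriv A x *\<^sub>R v' x =
        A x *\<^sub>R (v'' x + (deriv A x / A x) *\<^sub>R v' x)"
      using A_pos[OF x] by (simp add: scaleR_add_right)
    also have "v'' x + (deriv A x / A x) *\<^sub>R v' x = (\<eta> / (A x)\<^sup>2) *\<^sub>R v x - \<mu> * v x"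
      using v'(3)[OF x] by (simp add: algebra_simps)
    also have "A x *\<^sub>R ((\<eta> / (A x)\<^sup>2) *\<^sub>R v x - \<mu> * v x) =
        (of_real (\<eta> / A x) - \<mu> * of_real (A x)) * v x"
      using A_pos[OF x] by (simp add: scaleR_conv_of_real field_simps power2_eq_square)
    ultimately have "((\<lambda>x. A x *\<^sub>R v' x) has_vector_derivative
        (of_real (\<eta> / A x) - \<mu> * of_real (A x)) * v x) (at x)" by simp
    then show ?thesis
      by (rule has_vector_derivative_transform_within_open[of _ _ _ "{0<..}"])
         (use x in \<open>auto simp: G_def\<close>)
  qed
  have "continuous_on {0..} G"
  proof (rule continuous_on_eq_continuous_within[THEN iffD2], rule ballI)
    fix x :: real assume "x \<in> {0..}"
    show "continuous (at x within {0..}) G"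
    proof (cases "x = 0")
      case True
      have "(G \<longlongrightarrow> 0) (at_right 0)"
        by (rule Lim_transform_eventually[OF lim]) (auto simp: eventually_at_filter G_def)
      then show ?thesis
        using True by (simp add: continuous_within at_within_Ici_at_right G_def)
    next
      case False
      then have "isCont G x"
        using D[of x] \<open>x \<in> {0..}\<close> has_vector_derivative_continuous by fastforce
      then show ?thesis by (rule continuous_at_imp_continuous_within)
    qed
  qed
  moreover have "G 0 = 0" by (simp add: G_def)
  moreover have "(v has_vector_derivative (1 / A x) *\<^sub>R G x) (at x)" if "0 < x" for x
    using v'(1)[OF that] A_pos[OF that] that by (simp add: G_def)
  ultimately show thesis using D that by blast
qed

lemma v_increment:
  fixes v G :: "real \<Rightarrow> complex"
  assumes "0 \<le> s" "s < t" "continuous_on {0..} v"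
    and D: "\<And>x. 0 < x \<Longrightarrow> (v has_vector_derivative (1 / A x) *\<^sub>R G x) (at x)"
    and near: "\<And>x. s < x \<Longrightarrow> x < t \<Longrightarrow> norm (G x - g) \<le> \<epsilon>"
  shows "norm (v t - v s - of_real (T t - T s) * g) \<le> \<epsilon> * (T t - T s)"
proof -
  have "norm ((v t - of_real (T t) * g) - (v s - of_real (T s) * g)) \<le> \<epsilon> * T t - \<epsilon> * T s"
  proof (rule differentiable_bound_general[OF assms(2)])
    have T: "continuous_on {s..t} T"
      by (rule continuous_on_subset[OF T_cont[of t]]) (use assms in auto)
    show "continuous_on {s..t} (\<lambda>t. v t - of_real (T t) * g)"
      by (intro continuous_intros T continuous_on_subset[OF assms(3)]) (use assms in auto)
    show "continuous_on {s..t} (\<lambda>t. \<epsilon> * T t)" by (intro continuous_intros T)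
    fix x assume x: "s < x" "x < t"
    then have "0 < x" using assms by simp
    show "((\<lambda>t. v t - of_real (T t) * g) has_vector_derivative
        (1 / A x) *\<^sub>R G x - of_real (1 / A x) * g) (at x)"
      using T_deriv[OF \<open>0 < x\<close>]
      by (auto intro!: derivative_eq_intros D \<open>0 < x\<close> has_vector_derivative_of_real
          simp: has_real_derivative_iff_has_vector_derivative)
    show "((\<lambda>t. \<epsilon> * T t) has_vector_derivative \<epsilon> * (1 / A x)) (at x)"
      using DERIV_cmult[OF T_deriv[OF \<open>0 < x\<close>], of \<epsilon>]
      by (simp add: has_real_derivative_iff_has_vector_derivative)
    have "norm ((1 / A x) *\<^sub>R G x - of_real (1 / A x) * g) = norm (of_real (1 / A x) * (G x - g))"
      by (simp add: scaleR_conv_of_real algebra_simps diff_divide_distrib)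
    also have "\<dots> \<le> \<epsilon> * (1 / A x)"
      using near[OF x] A_pos[OF \<open>0 < x\<close>] by (simp add: norm_mult norm_divide divide_right_mono)
    finally show "norm ((1 / A x) *\<^sub>R G x - of_real (1 / A x) * g) \<le> \<epsilon> * (1 / A x)" .
  qed
  then show ?thesis by (simp add: algebra_simps)
qed

text \<open>The same comparison with the value frozen at \<open>u\<close>, dominated by
  \<open>\<epsilon> * (\<eta> * T + norm \<mu> * S)\<close>.\<close>

lemma flux_increment:
  fixes v G :: "real \<Rightarrow> complex"
  assumes "0 \<le> s" "s < t" "0 \<le> \<eta>" "continuous_on {0..} G"
    and D: "\<And>x. 0 < x \<Longrightarrow>
      (G has_vector_derivative (of_real (\<eta> / A x) - \<mu> * of_real (A x)) * v x) (at x)"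
    and near: "\<And>x. s < x \<Longrightarrow> x < t \<Longrightarrow> norm (v x - u) \<le> \<epsilon>"
  shows "norm (G t - G s - (of_real (\<eta> * (T t - T s)) - \<mu> * of_real (S t - S s)) * u)
      \<le> \<epsilon> * (\<eta> * (T t - T s) + norm \<mu> * (S t - S s))"
proof -
  have "norm ((G t - (of_real (\<eta> * T t) - \<mu> * of_real (S t)) * u) -
       (G s - (of_real (\<eta> * T s) - \<mu> * of_real (S s)) * u))
     \<le> \<epsilon> * (\<eta> * T t + norm \<mu> * S t) - \<epsilon> * (\<eta> * T s + norm \<mu> * S s)"
  proof (rule differentiable_bound_general[OF assms(2)])
    have TS: "continuous_on {s..t} T" "continuous_on {s..t} S"
      by (rule continuous_on_subset[OF T_cont[of t]] continuous_on_subset[OF S_cont[of t]];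
          use assms in auto)+
    show "continuous_on {s..t} (\<lambda>t. G t - (of_real (\<eta> * T t) - \<mu> * of_real (S t)) * u)"
      by (intro continuous_intros TS continuous_on_subset[OF assms(4)]) (use assms in auto)
    show "continuous_on {s..t} (\<lambda>t. \<epsilon> * (\<eta> * T t + norm \<mu> * S t))"
      by (intro continuous_intros TS)
    fix x assume x: "s < x" "x < t"
    then have "0 < x" using assms by simp
    show "((\<lambda>t. G t - (of_real (\<eta> * T t) - \<mu> * of_real (S t)) * u) has_vector_derivative
        (of_real (\<eta> / A x) - \<mu> * of_real (A x)) * v x
        - (of_real (\<eta> * (1 / A x)) - \<mu> * of_real (A x)) * u) (at x)"
      using T_deriv[OF \<open>0 < x\<close>] S_deriv[OF \<open>0 < x\<close>]
      by (auto intro!: derivative_eq_intros D \<open>0 < x\<close> has_vector_derivative_of_real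
          simp: has_real_derivative_iff_has_vector_derivative)
    show "((\<lambda>t. \<epsilon> * (\<eta> * T t + norm \<mu> * S t)) has_vector_derivative
        \<epsilon> * (\<eta> * (1 / A x) + norm \<mu> * A x)) (at x)"
      unfolding has_real_derivative_iff_has_vector_derivative[symmetric]
      by (intro DERIV_cmult DERIV_add T_deriv S_deriv \<open>0 < x\<close>)
    have "norm ((of_real (\<eta> / A x) - \<mu> * of_real (A x)) * v x
        - (of_real (\<eta> * (1 / A x)) - \<mu> * of_real (A x)) * u)
        = norm (of_real (\<eta> / A x) - \<mu> * of_real (A x)) * norm (v x - u)"
      by (simp add: algebra_simps diff_divide_distrib flip: norm_mult)
    also have "\<dots> \<le> (\<eta> * (1 / A x) + norm \<mu> * A x) * \<epsilon>"
      using A_pos[OF \<open>0 < x\<close>] assms(3)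
      by (intro mult_mono near x order_trans[OF norm_triangle_ineq4]) (auto simp: norm_mult norm_divide)
    finally show "norm ((of_real (\<eta> / A x) - \<mu> * of_real (A x)) * v x
        - (of_real (\<eta> * (1 / A x)) - \<mu> * of_real (A x)) * u)
        \<le> \<epsilon> * (\<eta> * (1 / A x) + norm \<mu> * A x)" by (simp add: mult.commute)
  qed
  then show ?thesis by (simp add: algebra_simps)
qed

section \<open>Discretisation of the radial equation\<close>

text \<open>
  The link between the nodes \<open>k h\<close> and \<open>(k + 1) h\<close> carries the conductance \<open>A ((k + 1) h)\<close>, so the
  possible zero of \<open>A\<close> at \<open>0\<close> is never sampled; the value \<open>0\<close> at \<open>k = 0\<close> encodes the reflecting
  boundary.
\<close>

definition grid :: "real \<Rightarrow> nat \<Rightarrow> real" where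
  "grid h k = (if k = 0 then 0 else A (real k * h))"

definition potential :: "real \<Rightarrow> real \<Rightarrow> nat \<Rightarrow> real" where
  "potential h \<eta> k = - (h\<^sup>2 / 2 * \<eta> / (grid h (Suc k))\<^sup>2)"

lemma grid_Suc_pos: "0 < h \<Longrightarrow> 0 < grid h (Suc k)"
  by (simp add: grid_def A_pos)

lemma grid_mono: "0 < h \<Longrightarrow> grid h k \<le> grid h (Suc k)"
  by (auto simp: grid_def A_nonneg algebra_simps intro!: A_mono)

lemma grid_chain:
  assumes "0 < h" "0 \<le> \<eta>"
  shows "log_concave_chain (grid h) (potential h \<eta>)"
proof
  show "grid h 0 = 0" by (simp add: grid_def)
  show "0 < grid h (Suc n)" "grid h n \<le> grid h (Suc n)" for n
    using assms grid_Suc_pos grid_mono by auto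
  show "grid h n * grid h (Suc (Suc n)) \<le> (grid h (Suc n))\<^sup>2" for n
  proof (cases n)
    case (Suc k)
    have "0 < h + h * real k" using assms by (simp add: add_pos_nonneg)
    then show ?thesis
      using assms A_log_concave[of "real n * h" h] Suc by (auto simp: grid_def algebra_simps)
  qed (simp add: grid_def)
  have "potential h \<eta> k \<le> potential h \<eta> (Suc k)" for k
  proof -
    have "h\<^sup>2 / 2 * \<eta> / (grid h (Suc (Suc k)))\<^sup>2 \<le> h\<^sup>2 / 2 * \<eta> / (grid h (Suc k))\<^sup>2"
      using assms grid_Suc_pos[of h k] grid_Suc_pos[of h "Suc k"] grid_mono[of h "Suc k"]
      by (intro divide_left_mono mult_pos_pos power_mono) auto
    then show ?thesis by (simp add: potential_def)
  qed
  then show "mono (potential h \<eta>)" by (simp add: mono_iff_le_Suc)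
qed

lemma potential_nonpos: "0 \<le> \<eta> \<Longrightarrow> potential h \<eta> k \<le> 0"
  by (simp add: potential_def)

text \<open>
  The spectral parameter \<open>1 - h\<^sup>2 \<mu> / 2\<close> makes the recurrence
  \<open>b\<^sub>k\<^sub>+\<^sub>1 (u\<^sub>k\<^sub>+\<^sub>1 - u\<^sub>k) - b\<^sub>k (u\<^sub>k - u\<^sub>k\<^sub>-\<^sub>1) = (b\<^sub>k + b\<^sub>k\<^sub>+\<^sub>1) (h\<^sup>2 / 2) (\<eta> / b\<^sub>k\<^sub>+\<^sub>1\<^sup>2 - \<mu>) u\<^sub>k\<close>.
\<close>

definition approx :: "real \<Rightarrow> real \<Rightarrow> complex \<Rightarrow> nat \<Rightarrow> complex" where
  "approx h \<eta> \<mu> = log_concave_chain.P (grid h) (potential h \<eta>) (1 - of_real (h\<^sup>2 / 2) * \<mu>)"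

text \<open>The error of the right Riemann sum for the decreasing function 1 / A. Each cell after
  the first contributes at most a difference of consecutive values of \<open>h / grid h k\<close>,
  so the sum telescopes; its bound does not depend on \<open>n\<close> and tends to 0 with
  \<open>h\<close>.\<close>

lemma T_defect_sum:
  assumes "0 < h"
  shows "(\<Sum>k<n. T (real (Suc k) * h) - T (real k * h) - h / grid h (Suc k)) \<le> T h"
proof -
  have *: "(\<Sum>k<Suc n. T (real (Suc k) * h) - T (real k * h) - h / grid h (Suc k)) \<le> T h - h / grid h (Suc n)" for n
  proof (induction n)
    case (Suc n)
    have "0 < h + h * real n" using assms by (simp add: add_pos_nonneg)
    then have "T (real (Suc (Suc n)) * h) - T (real (Suc n) * h) \<le> h / grid h (Suc n)"
      using T_increment(2)[of "real (Suc n) * h" "real (Suc (Suc n)) * h"] assms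
      by (simp add: grid_def algebra_simps)
    then show ?case using Suc by simp
  qed simp
  show ?thesis
  proof (cases n)
    case 0
    then show ?thesis using T_mono[of 0 h] assms by simp
  next
    case (Suc n')
    have "0 \<le> h / grid h (Suc n')" using grid_Suc_pos[OF assms, of n'] assms by simp
    then show ?thesis using *[of n'] unfolding Suc by linarith
  qed
qed

text \<open>The summand is the gap between \<open>h / grid h (Suc k)\<close> and the same expression
  with one factor averaged over the two adjacent links. Replacing one factor of the squared
  denominator by \<open>grid h k\<close> makes the sum telescope.\<close>

lemma grid_defect_sum:
  assumes "0 < h"
  shows "(\<Sum>k<n. h * (grid h (Suc k) - grid h k) / (2 * (grid h (Suc k))\<^sup>2)) \<le> T h"
proof -
  have *: "(\<Sum>k<Suc n. h * (grid h (Suc k) - grid h k) / (2 * (grid h (Suc k))\<^sup>2))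
      \<le> h / grid h 1 - h / (2 * grid h (Suc n))" for n
  proof (induction n)
    case 0
    show ?case using grid_Suc_pos[OF assms, of 0] by (simp add: grid_def field_simps power2_eq_square)
  next
    case (Suc n)
    let ?b = "grid h (Suc n)" and ?c = "grid h (Suc (Suc n))"
    have b: "0 < ?b" "?b \<le> ?c" using grid_Suc_pos grid_mono assms by auto
    have "h * (?c - ?b) / (2 * ?c\<^sup>2) \<le> h * (?c - ?b) / (2 * (?b * ?c))"
      using b assms by (intro divide_left_mono mult_left_mono mult_pos_pos) (auto simp: power2_eq_square)
    also have "\<dots> = h / (2 * ?b) - h / (2 * ?c)" using b by (simp add: field_simps)
    finally show ?case using Suc by simp
  qed
  have Th: "h / grid h 1 \<le> T h"
    using T_increment(1)[of 0 h] assms by (simp add: grid_def)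
  show ?thesis
  proof (cases n)
    case 0
    then show ?thesis using T_mono[of 0 h] assms by simp
  next
    case (Suc n')
    have "0 \<le> h / (2 * grid h (Suc n'))" using grid_Suc_pos[OF assms, of n'] assms by simp
    then show ?thesis using *[of n'] Th Suc by simp
  qed
qed

text \<open>Value and flux of the discrete solution obey a two-step scheme that the exact pair
  \<open>v\<close>, \<open>G\<close> satisfies up to defects, and \<open>discrete_gronwall\<close>
  adds these up. A defect has a part from freezing \<open>v\<close> or \<open>G\<close> over a cell,
  controlled by \<open>near\<close>, and a quadrature part, whose sum is small because
  \<open>T h\<close> and \<open>h\<close> are small.\<close>

lemma approx_error:
  fixes v G :: "real \<Rightarrow> complex"
  assumes h: "0 < h" "h \<le> \<epsilon>" "T h \<le> \<epsilon>" and \<eta>: "0 \<le> \<eta>" and N: "real N * h \<le> X"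
    and cont: "continuous_on {0..} v" "continuous_on {0..} G" and init: "v 0 = 1" "G 0 = 0"
    and Dv: "\<And>x. 0 < x \<Longrightarrow> (v has_vector_derivative (1 / A x) *\<^sub>R G x) (at x)"
    and DG: "\<And>x. 0 < x \<Longrightarrow>
      (G has_vector_derivative (of_real (\<eta> / A x) - \<mu> * of_real (A x)) * v x) (at x)"
    and near: "\<And>s t. 0 \<le> s \<Longrightarrow> s \<le> t \<Longrightarrow> t \<le> X \<Longrightarrow> t - s \<le> h \<Longrightarrow>
      norm (v t - v s) \<le> \<epsilon> \<and> norm (G t - G s) \<le> \<epsilon>"
    and C: "\<And>t. 0 \<le> t \<Longrightarrow> t \<le> X \<Longrightarrow> norm (v t) \<le> C \<and> norm (G t) \<le> C"
  shows "norm (v (real N * h) - approx h \<eta> \<mu> N) \<le>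
    exp ((1 + \<eta>) * T X + norm \<mu> * (X * A X)) *
    (\<epsilon> * (T X + C + (\<eta> * T X + norm \<mu> * S X) + C * (2 * \<eta> + norm \<mu> * A X)))"
proof -
  interpret C: log_concave_chain "grid h" "potential h \<eta>"
    using h \<eta> by (intro grid_chain) auto
  define b where "b = grid h"
  have b: "0 < b (Suc k)" "0 \<le> b k" "b k \<le> b (Suc k)" for k
    using C.b_pos C.b_nonneg C.b_mono by (auto simp: b_def)
  have X: "0 \<le> X" using N h by (metis mult_nonneg_nonneg less_imp_le of_nat_0_le_iff order_trans)
  have kX: "real k * h \<le> X" if "k \<le> N" for k
  proof -
    have "real k * h \<le> real N * h" using that h by (intro mult_right_mono) auto
    then show ?thesis using N by simp
  qed
  have AX: "0 \<le> A X" and TX: "0 \<le> T X" and SX: "0 \<le> S X" and C0: "0 \<le> C"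
    using X A_nonneg T_mono[of 0 X] S_mono[of 0 X] order_trans[OF norm_ge_zero[of "v X"]] C[of X] by auto
  have bX: "b k \<le> A X" if "k \<le> N" for k
    using that kX[of k] h AX by (auto simp: b_def grid_def intro!: A_mono)
  define p where "p k = approx h \<eta> \<mu> k" for k
  \<comment> \<open>The discrete flux through the link from k - 1 to k, with no flux at the
    reflecting end. The recurrence becomes \<open>F (Suc k) = F k + Q k * p k\<close> and
    \<open>p (Suc k) = p k + of_real (x k) * F (Suc k)\<close>.\<close>
  define F where "F k = (if k = 0 then 0 else of_real (b k / h) * (p k - p (k - 1)))" for k
  define x where "x k = h / b (Suc k)" for k
  define Q where "Q k = of_real (h * (b k + b (Suc k)) / 2) * (of_real (\<eta> / (b (Suc k))\<^sup>2) - \<mu>)" for k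
  define y where "y k = \<eta> * x k + norm \<mu> * (h * A X)" for k
  define dT where "dT k = T (real (Suc k) * h) - T (real k * h)" for k
  define dS where "dS k = S (real (Suc k) * h) - S (real k * h)" for k
  \<comment> \<open>\<open>\<rho>\<close> and \<open>\<tau>\<close> are the defects of the exact
    solution in the scheme, \<open>e\<close> and \<open>E\<close> the errors of value and flux,
    \<open>\<delta>\<close> and \<open>\<kappa>\<close> the quadrature errors.\<close>
  define \<rho> where "\<rho> k = v (real (Suc k) * h) - v (real k * h) - of_real (x k) * G (real (Suc k) * h)" for k
  define \<tau> where "\<tau> k = G (real (Suc k) * h) - G (real k * h) - Q k * v (real k * h)" for k
  define e where "e k = v (real k * h) - p k" for k
  define E where "E k = G (real k * h) - F k" for k
  define \<delta> where "\<delta> k = dT k - x k" for k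
  define \<kappa> where "\<kappa> k = h * (b (Suc k) - b k) / (2 * (b (Suc k))\<^sup>2)" for k
  have P_Suc: "p (Suc k) = p k + of_real (x k) * F (Suc k)" for k
    using b[of k] h by (simp add: F_def x_def)
  have F_Suc: "F (Suc k) = F k + Q k * p k" for k
  proof -
    have w: "b k + b (Suc k) = C.w k" by (simp add: C.w_def b_def)
    have "of_real (b k + b (Suc k)) * (1 - of_real (h\<^sup>2 / 2) * \<mu>) * p k =
        of_real (b (Suc k)) * p (Suc k) + of_real (b k) * p (k - 1)
        + of_real ((b k + b (Suc k)) * potential h \<eta> k) * p k"
      unfolding w unfolding p_def approx_def b_def by (rule C.P_recurrence)
    then have "of_real (b (Suc k)) * (p (Suc k) - p k) = of_real (b k) * (p k - p (k - 1))
        + (of_real (b k) + of_real (b (Suc k))) * (- of_real (h\<^sup>2 / 2) * \<mu> - of_real (potential h \<eta> k)) * p k"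
      by (simp add: algebra_simps add_divide_distrib)
    also have "(of_real (b k) + of_real (b (Suc k))) * (- of_real (h\<^sup>2 / 2) * \<mu> - of_real (potential h \<eta> k))
        = of_real h * Q k"
      using h by (simp add: Q_def potential_def power2_eq_square field_simps flip: b_def)
    finally have *: "of_real (b (Suc k)) * (p (Suc k) - p k) =
        of_real (b k) * (p k - p (k - 1)) + of_real h * Q k * p k" .
    have "F (Suc k) = of_real (b (Suc k)) * (p (Suc k) - p k) / of_real h"
      by (simp add: F_def)
    also have "\<dots> = F k + Q k * p k"
      unfolding * using h by (simp add: F_def add_divide_distrib)
    finally show ?thesis .
  qed
  have x_le: "x k \<le> dT k" and x_nonneg: "0 \<le> x k" and dS_nonneg: "0 \<le> dS k" for k
    using T_increment(1)[of "real k * h" "real (Suc k) * h"] S_mono[of "real k * h" "real (Suc k) * h"] h b[of k]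
    by (auto simp: x_def dT_def dS_def b_def grid_def algebra_simps)
  then have dT_nonneg: "0 \<le> dT k" and \<delta>_nonneg: "0 \<le> \<delta> k" for k
    using order_trans[OF x_nonneg x_le] by (auto simp: \<delta>_def)
  have \<kappa>_nonneg: "0 \<le> \<kappa> k" for k using h b[of k] by (simp add: \<kappa>_def)
  have Q_le: "norm (Q k) \<le> y k" if "k < N" for k
  proof -
    have "norm (Q k) = h * (b k + b (Suc k)) / 2 * norm (of_real (\<eta> / (b (Suc k))\<^sup>2) - \<mu>)"
      unfolding Q_def norm_mult norm_of_real using h b[of k] by simp
    also have "\<dots> \<le> h * b (Suc k) * (\<eta> / (b (Suc k))\<^sup>2 + norm \<mu>)"
      using h b[of k] \<eta>
      by (intro mult_mono order_trans[OF norm_triangle_ineq4]) (auto simp: norm_divide norm_power)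
    also have "\<dots> = \<eta> * x k + norm \<mu> * (h * b (Suc k))"
      using b[of k] by (simp add: x_def field_simps power2_eq_square)
    also have "\<dots> \<le> y k"
      unfolding y_def using bX[of "Suc k"] that h by (intro add_left_mono mult_left_mono) auto
    finally show ?thesis .
  qed
  have Gronwall: "norm (e N) + norm (E N) \<le> exp (\<Sum>k<N. x k + y k) * (\<Sum>k<N. norm (\<rho> k) + norm (\<tau> k))"
  proof (rule discrete_gronwall)
    show "norm (e 0) = 0" "norm (E 0) = 0"
      by (simp_all add: e_def E_def F_def init p_def approx_def)
    show "0 \<le> y k" for k using \<eta> x_nonneg h AX by (simp add: y_def)
    fix k assume k: "k < N"
    have "E (Suc k) = E k + Q k * e k + \<tau> k"
      by (simp add: E_def e_def \<tau>_def F_Suc algebra_simps)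
    then have "norm (E (Suc k)) \<le> norm (E k) + norm (Q k) * norm (e k) + norm (\<tau> k)"
      by (metis norm_mult norm_triangle_mono norm_triangle_ineq order_refl)
    also have "\<dots> \<le> norm (E k) + y k * norm (e k) + norm (\<tau> k)"
      by (intro add_mono mult_right_mono Q_le k) auto
    finally show "norm (E (Suc k)) \<le> norm (E k) + y k * norm (e k) + norm (\<tau> k)" .
    have "e (Suc k) = e k + of_real (x k) * E (Suc k) + \<rho> k"
      by (simp add: E_def e_def \<rho>_def P_Suc algebra_simps)
    then have "norm (e (Suc k)) \<le> norm (e k) + norm (of_real (x k) * E (Suc k)) + norm (\<rho> k)"
      by (metis norm_triangle_mono norm_triangle_ineq order_refl)
    then show "norm (e (Suc k)) \<le> norm (e k) + x k * norm (E (Suc k)) + norm (\<rho> k)"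
      using x_nonneg by (simp add: norm_mult)
  qed (auto simp: x_nonneg)
  have \<rho>_le: "norm (\<rho> k) \<le> \<epsilon> * dT k + C * \<delta> k" if "k < N" for k
  proof -
    have g: "norm (v (real (Suc k) * h) - v (real k * h) - of_real (dT k) * G (real (Suc k) * h)) \<le> \<epsilon> * dT k"
      unfolding dT_def
    proof (rule v_increment[OF _ _ cont(1) Dv])
      fix z assume z: "real k * h < z" "z < real (Suc k) * h"
      have "0 \<le> real k * h" using h by simp
      then show "norm (G z - G (real (Suc k) * h)) \<le> \<epsilon>"
        using near[of z "real (Suc k) * h"] z kX[of "Suc k"] that
        by (simp add: norm_minus_commute algebra_simps)
    qed (use h in auto)
    have "\<rho> k = (v (real (Suc k) * h) - v (real k * h) - of_real (dT k) * G (real (Suc k) * h))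
        + of_real (\<delta> k) * G (real (Suc k) * h)"
      by (simp add: \<rho>_def \<delta>_def algebra_simps)
    then have "norm (\<rho> k) \<le> \<epsilon> * dT k + norm (of_real (\<delta> k) * G (real (Suc k) * h))"
      using g norm_triangle_le[OF add_mono[OF g order_refl]] by simp
    also have "norm (of_real (\<delta> k) * G (real (Suc k) * h)) \<le> C * \<delta> k"
      using C[of "real (Suc k) * h"] kX[of "Suc k"] that \<delta>_nonneg[of k] h
        mult_left_mono[of "norm (G (real (Suc k) * h))" C "\<delta> k"]
      by (simp add: norm_mult mult.commute[of C])
    finally show ?thesis by simp
  qed
  have \<tau>_le: "norm (\<tau> k) \<le> \<epsilon> * (\<eta> * dT k + norm \<mu> * dS k)
      + C * (\<eta> * (\<delta> k + \<kappa> k) + norm \<mu> * (h * (b (Suc k) - b k)))" if "k < N" for k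
  proof -
    have g: "norm (G (real (Suc k) * h) - G (real k * h)
        - (of_real (\<eta> * dT k) - \<mu> * of_real (dS k)) * v (real k * h))
        \<le> \<epsilon> * (\<eta> * dT k + norm \<mu> * dS k)"
      unfolding dT_def dS_def
    proof (rule flux_increment[OF _ _ \<eta> cont(2) DG])
      fix z assume z: "real k * h < z" "z < real (Suc k) * h"
      have "0 \<le> real k * h" using h by simp
      then show "norm (v z - v (real k * h)) \<le> \<epsilon>"
        using near[of "real k * h" z] z kX[of "Suc k"] that
        by (simp add: algebra_simps)
    qed (use h in auto)
    let ?d = "dS k - h * (b k + b (Suc k)) / 2"
    \<comment> \<open>Both \<open>dS k\<close> and the averaged weight lie between
      \<open>h * b k\<close> and \<open>h * b (Suc k)\<close>.\<close>
    have d: "\<bar>?d\<bar> \<le> h * (b (Suc k) - b k)"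
    proof -
      have "h * b k \<le> dS k" "dS k \<le> h * b (Suc k)"
        using S_increment[of "real k * h" "real (Suc k) * h"] h dS_nonneg[of k]
        by (auto simp: dS_def b_def grid_def algebra_simps)
      moreover have "\<bar>d - (l + u) / 2\<bar> \<le> u - l" if "l \<le> d" "d \<le> u" for d l u :: real
        using that by (auto simp: abs_le_iff field_simps)
      ultimately show ?thesis
        unfolding right_diff_distrib distrib_left by blast
    qed
    \<comment> \<open>The coefficient of \<open>\<eta>\<close> in \<open>Q k\<close> misses
      \<open>dT k\<close> for two reasons: the Riemann sum, which gives \<open>\<delta> k\<close>,
      and the averaging of adjacent links, which gives \<open>\<kappa> k\<close>.\<close>
    have c: "\<delta> k + \<kappa> k = dT k - h * (b k + b (Suc k)) / 2 / (b (Suc k))\<^sup>2"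
      using b[of k] by (simp add: \<delta>_def \<kappa>_def x_def field_simps power2_eq_square)
    have "of_real (\<eta> * dT k) - \<mu> * of_real (dS k) - Q k =
        of_real (\<eta> * (\<delta> k + \<kappa> k)) - \<mu> * of_real ?d"
      unfolding c Q_def by (simp add: algebra_simps add_divide_distrib diff_divide_distrib)
    then have q: "norm (of_real (\<eta> * dT k) - \<mu> * of_real (dS k) - Q k)
        \<le> \<eta> * (\<delta> k + \<kappa> k) + norm \<mu> * (h * (b (Suc k) - b k))"
      using d \<eta> \<delta>_nonneg[of k] \<kappa>_nonneg[of k]
      by (auto intro!: order_trans[OF norm_triangle_ineq4] add_mono mult_left_mono
            simp: norm_mult simp del: of_real_diff of_real_add of_real_divide of_real_mult)
    have "\<tau> k = (G (real (Suc k) * h) - G (real k * h)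
        - (of_real (\<eta> * dT k) - \<mu> * of_real (dS k)) * v (real k * h))
        + (of_real (\<eta> * dT k) - \<mu> * of_real (dS k) - Q k) * v (real k * h)"
      by (simp add: \<tau>_def algebra_simps)
    then have "norm (\<tau> k) \<le> \<epsilon> * (\<eta> * dT k + norm \<mu> * dS k)
        + norm ((of_real (\<eta> * dT k) - \<mu> * of_real (dS k) - Q k) * v (real k * h))"
      using norm_triangle_le[OF add_mono[OF g order_refl]] by simp
    also have "norm ((of_real (\<eta> * dT k) - \<mu> * of_real (dS k) - Q k) * v (real k * h))
        \<le> (\<eta> * (\<delta> k + \<kappa> k) + norm \<mu> * (h * (b (Suc k) - b k))) * C"
      unfolding norm_mult
      using C[of "real k * h"] kX[of k] that h \<eta> \<delta>_nonneg[of k] \<kappa>_nonneg[of k] b[of k]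
      by (intro mult_mono q) auto
    finally show ?thesis by (simp add: mult.commute)
  qed
  have sum_dT: "(\<Sum>k<N. dT k) \<le> T X" and sum_dS: "(\<Sum>k<N. dS k) \<le> S X"
    using T_mono[of "real N * h" X] S_mono[of "real N * h" X] N h
    unfolding dT_def dS_def
    by (simp_all only: sum_lessThan_telescope[of "\<lambda>k. T (real k * h)"] sum_lessThan_telescope[of "\<lambda>k. S (real k * h)"]) auto
  have sum_\<delta>: "(\<Sum>k<N. \<delta> k) \<le> \<epsilon>"
    using T_defect_sum[of h N] h by (simp add: \<delta>_def dT_def x_def b_def)
  have sum_\<kappa>: "(\<Sum>k<N. \<kappa> k) \<le> \<epsilon>"
    using grid_defect_sum[of h N] h by (simp add: \<kappa>_def b_def)
  have sum_b: "(\<Sum>k<N. b (Suc k) - b k) \<le> A X"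
    using bX[of N] by (simp add: sum_lessThan_telescope) (simp add: b_def grid_def)
  have "(\<Sum>k<N. x k + y k) \<le> (1 + \<eta>) * T X + norm \<mu> * (X * A X)"
  proof -
    have "(\<Sum>k<N. x k + y k) = (1 + \<eta>) * (\<Sum>k<N. x k) + norm \<mu> * (real N * h * A X)"
      by (simp add: y_def sum.distrib sum_distrib_left[symmetric] algebra_simps)
    also have "\<dots> \<le> (1 + \<eta>) * T X + norm \<mu> * (X * A X)"
      using \<eta> AX N order_trans[OF sum_mono[OF x_le] sum_dT]
      by (intro add_mono mult_left_mono mult_right_mono) auto
    finally show ?thesis .
  qed
  moreover have "(\<Sum>k<N. norm (\<rho> k) + norm (\<tau> k)) \<le>
      \<epsilon> * (T X + C + (\<eta> * T X + norm \<mu> * S X) + C * (2 * \<eta> + norm \<mu> * A X))"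
  proof -
    have "(\<Sum>k<N. norm (\<rho> k) + norm (\<tau> k)) \<le> (\<Sum>k<N. (\<epsilon> * dT k + C * \<delta> k) +
        (\<epsilon> * (\<eta> * dT k + norm \<mu> * dS k)
          + C * (\<eta> * (\<delta> k + \<kappa> k) + norm \<mu> * (h * (b (Suc k) - b k)))))"
      by (intro sum_mono add_mono \<rho>_le \<tau>_le) auto
    also have "\<dots> = (\<epsilon> * (\<Sum>k<N. dT k) + C * (\<Sum>k<N. \<delta> k)) +
        (\<epsilon> * (\<eta> * (\<Sum>k<N. dT k) + norm \<mu> * (\<Sum>k<N. dS k))
          + C * (\<eta> * ((\<Sum>k<N. \<delta> k) + (\<Sum>k<N. \<kappa> k)) + norm \<mu> * (h * (\<Sum>k<N. b (Suc k) - b k))))"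
      by (simp only: sum_distrib_left flip: sum.distrib)
    also have "\<dots> \<le> (\<epsilon> * T X + C * \<epsilon>) +
        (\<epsilon> * (\<eta> * T X + norm \<mu> * S X) + C * (\<eta> * (\<epsilon> + \<epsilon>) + norm \<mu> * (\<epsilon> * A X)))"
    proof -
      have "0 \<le> (\<Sum>k<N. b (Suc k) - b k)" using b by (intro sum_nonneg) auto
      then have hb: "h * (\<Sum>k<N. b (Suc k) - b k) \<le> \<epsilon> * A X"
        using h by (intro mult_mono sum_b) auto
      have "0 \<le> \<epsilon>" using h by simp
      then show ?thesis
        by (intro add_mono mult_left_mono hb sum_dT sum_dS sum_\<delta> sum_\<kappa> \<eta> C0 norm_ge_zero)
    qed
    also have "\<dots> = \<epsilon> * (T X + C + (\<eta> * T X + norm \<mu> * S X) + C * (2 * \<eta> + norm \<mu> * A X))"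
      by (simp add: algebra_simps)
    finally show ?thesis .
  qed
  ultimately have "exp (\<Sum>k<N. x k + y k) * (\<Sum>k<N. norm (\<rho> k) + norm (\<tau> k)) \<le>
      exp ((1 + \<eta>) * T X + norm \<mu> * (X * A X)) *
      (\<epsilon> * (T X + C + (\<eta> * T X + norm \<mu> * S X) + C * (2 * \<eta> + norm \<mu> * A X)))"
    by (intro mult_mono) (auto intro!: sum_nonneg)
  moreover have "norm (v (real N * h) - approx h \<eta> \<mu> N) = norm (e N)"
    by (simp add: e_def p_def)
  ultimately show ?thesis using Gronwall norm_ge_zero[of "E N"] by linarith
qed

section \<open>The radial product formula\<close>

text \<open>On the compact interval \<open>v\<close> and its flux are bounded and uniformly
  continuous, so \<open>approx_error\<close> applies with an arbitrarily small tolerance. Uniformity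
  over all nodes is what later allows averaging against weights that vary with the mesh.\<close>

lemma approx_uniform_limit:
  assumes v: "radial_solution A \<mu> \<eta> v" and \<eta>: "0 \<le> \<eta>" and X: "0 \<le> X" and \<epsilon>: "0 < \<epsilon>"
  shows "\<forall>\<^sub>F h in at_right 0. \<forall>N. real N * h \<le> X \<longrightarrow> norm (v (real N * h) - approx h \<eta> \<mu> N) < \<epsilon>"
proof -
  obtain G where G: "continuous_on {0..} G" "G 0 = 0"
    "\<And>x. 0 < x \<Longrightarrow> (v has_vector_derivative (1 / A x) *\<^sub>R G x) (at x)"
    "\<And>x. 0 < x \<Longrightarrow>
      (G has_vector_derivative (of_real (\<eta> / A x) - \<mu> * of_real (A x)) * v x) (at x)"
    using radial_flux[OF v] by metis
  have v0: "continuous_on {0..} v" "v 0 = 1"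
    using v by (auto simp: radial_solution_def)
  have cX: "continuous_on {0..X} v" "continuous_on {0..X} G"
    by (rule continuous_on_subset[OF v0(1)] continuous_on_subset[OF G(1)]; auto)+
  obtain C1 C2 where "\<And>t. t \<in> {0..X} \<Longrightarrow> norm (v t) \<le> C1" "\<And>t. t \<in> {0..X} \<Longrightarrow> norm (G t) \<le> C2"
    using cX compact_continuous_image[OF _ compact_Icc] compact_imp_bounded
    by (metis (no_types, lifting) bounded_iff image_eqI)
  then have C: "norm (v t) \<le> max C1 C2 \<and> norm (G t) \<le> max C1 C2" if "0 \<le> t" "t \<le> X" for t
    using that by (simp add: le_max_iff_disj)
  \<comment> \<open>The factor of the tolerance in \<open>approx_error\<close>; it involves neither
    \<open>h\<close> nor \<open>N\<close>.\<close>
  define K where "K = exp ((1 + \<eta>) * T X + norm \<mu> * (X * A X)) *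
    (T X + max C1 C2 + (\<eta> * T X + norm \<mu> * S X) + max C1 C2 * (2 * \<eta> + norm \<mu> * A X))"
  define e where "e = \<epsilon> / (\<bar>K\<bar> + 1)"
  have e: "0 < e" "e * K < \<epsilon>"
  proof -
    show "0 < e" using \<epsilon> by (simp add: e_def)
    have "e * K \<le> e * \<bar>K\<bar>" using \<open>0 < e\<close> by (intro mult_left_mono) auto
    also have "\<dots> < e * (\<bar>K\<bar> + 1)" using \<open>0 < e\<close> by simp
    also have "\<dots> = \<epsilon>" by (simp add: e_def)
    finally show "e * K < \<epsilon>" .
  qed
  have uc: "uniformly_continuous_on {0..X} v" "uniformly_continuous_on {0..X} G"
    using cX by (auto intro: compact_uniformly_continuous)
  obtain d1 where d1: "0 < d1" "\<And>s t. s \<in> {0..X} \<Longrightarrow> t \<in> {0..X} \<Longrightarrow> dist t s < d1 \<Longrightarrow> dist (v t) (v s) < e"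
    using uc(1) e(1) unfolding uniformly_continuous_on_def by metis
  obtain d2 where d2: "0 < d2" "\<And>s t. s \<in> {0..X} \<Longrightarrow> t \<in> {0..X} \<Longrightarrow> dist t s < d2 \<Longrightarrow> dist (G t) (G s) < e"
    using uc(2) e(1) unfolding uniformly_continuous_on_def by metis
  have "(T \<longlongrightarrow> T 0) (at 0 within {0..1})"
    using T_cont[of 1, unfolded continuous_on_def, rule_format, of 0] by simp
  then have "(T \<longlongrightarrow> 0) (at_right 0)"
    by (simp add: at_within_Icc_at_right)
  then have "\<forall>\<^sub>F h in at_right 0. T h < e"
    using e(1) by (auto dest: order_tendstoD)
  moreover have "\<forall>\<^sub>F h in at_right 0. h \<in> {0<..<Min {e, d1, d2}}"
    using e(1) d1(1) d2(1) by (intro eventually_at_right_real) auto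
  ultimately show ?thesis
  proof eventually_elim
    case (elim h)
    then have h: "0 < h" "h < e" "h < d1" "h < d2" "T h < e" by auto
    have near: "norm (v t - v s) \<le> e \<and> norm (G t - G s) \<le> e"
      if "0 \<le> s" "s \<le> t" "t \<le> X" "t - s \<le> h" for s t
      using that h d1(2)[of s t] d2(2)[of s t] by (auto simp: dist_norm less_imp_le)
    show ?case
    proof (intro allI impI)
      fix N assume N: "real N * h \<le> X"
      have "norm (v (real N * h) - approx h \<eta> \<mu> N) \<le>
        exp ((1 + \<eta>) * T X + norm \<mu> * (X * A X)) *
        (e * (T X + max C1 C2 + (\<eta> * T X + norm \<mu> * S X) + max C1 C2 * (2 * \<eta> + norm \<mu> * A X)))"
        using h by (intro approx_error[OF _ _ _ \<eta> N v0(1) G(1) v0(2) G(2-4) near C]) auto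
      also have "\<dots> = e * K" by (simp add: K_def)
      finally show "norm (v (real N * h) - approx h \<eta> \<mu> N) < \<epsilon>" using e by linarith
    qed
  qed
qed

lemma approx_limit:
  assumes v: "radial_solution A \<mu> \<eta> v" and "0 \<le> \<eta>" "0 \<le> x"
  shows "(\<lambda>j. approx (mesh j) \<eta> \<mu> (index x j)) \<longlonglongrightarrow> v x"
proof -
  have "(\<lambda>j. v (real (index x j) * mesh j) - approx (mesh j) \<eta> \<mu> (index x j)) \<longlonglongrightarrow> 0"
  proof (rule tendstoI)
    fix \<epsilon> :: real assume "0 < \<epsilon>"
    from filterlim_iff[THEN iffD1, OF mesh_limit, rule_format, OF approx_uniform_limit[OF v assms(2,3) this]]
    show "\<forall>\<^sub>F j in sequentially. dist (v (real (index x j) * mesh j) - approx (mesh j) \<eta> \<mu> (index x j)) 0 < \<epsilon>"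
      by eventually_elim (use index_bounds(1)[OF assms(3)] in auto)
  qed
  moreover have "(\<lambda>j. v (real (index x j) * mesh j)) \<longlonglongrightarrow> v x"
    using v assms(3) less_imp_le[OF mesh_pos]
    by (intro continuous_on_tendsto_compose[OF _ index_limit[OF assms(3)]])
       (auto simp: radial_solution_def)
  ultimately show ?thesis
    using tendsto_diff by fastforce
qed

text \<open>At \<open>\<mu> = 0\<close> the spectral parameter is 1 and the potential is
  nonpositive, so \<open>P_one_ge_1\<close> applies.\<close>

lemma approx_zero:
  assumes "0 < h" "0 \<le> \<eta>"
  obtains r where "approx h \<eta> 0 k = of_real r" "1 \<le> r"
proof -
  interpret C: log_concave_chain "grid h" "potential h \<eta>"
    using assms by (rule grid_chain)
  have "approx h \<eta> 0 k = of_real (C.P (1::real) k)"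
    using C.P_of_real[where 'a=complex, of 1 k] by (simp add: approx_def)
  then show thesis using that C.P_one_ge_1 potential_nonpos assms by blast
qed

lemma radial_zero_ge_1:
  assumes v: "radial_solution A 0 \<eta> v" and "0 \<le> \<eta>" "0 \<le> x"
  shows "v x = of_real (Re (v x))" "1 \<le> Re (v x)"
proof -
  note lim = approx_limit[OF assms]
  have "Im (approx (mesh j) \<eta> 0 (index x j)) = 0" "1 \<le> Re (approx (mesh j) \<eta> 0 (index x j))" for j
    using approx_zero[OF mesh_pos[of j] assms(2), of "index x j"] by (metis Im_complex_of_real Re_complex_of_real)+
  then have "Im (v x) = 0" "1 \<le> Re (v x)"
    using tendsto_Im[OF lim] LIMSEQ_le_const[OF tendsto_Re[OF lim]]
    by (auto simp: LIMSEQ_const_iff)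
  then show "v x = of_real (Re (v x))" "1 \<le> Re (v x)" by (auto simp: complex_eq_iff)
qed

text \<open>The order \<open>y \<le> x\<close> is the one for which the linearization coefficients
  are known to be nonnegative. The weak limit is selected before any \<open>\<mu>\<close> is
  considered, so one measure serves all spectral parameters.\<close>

lemma radial_product_formula_ordered:
  assumes v: "\<And>\<mu>. radial_solution A \<mu> \<eta> (v \<mu>)" and \<eta>: "0 \<le> \<eta>" and xy: "0 \<le> y" "y \<le> x"
  shows "\<exists>\<nu>. sets \<nu> = sets (restrict_space borel {0..}) \<and> finite_measure \<nu> \<and>
    (\<forall>\<mu>. integrable \<nu> (v \<mu>) \<and> v \<mu> x * v \<mu> y = (\<integral>t. v \<mu> t \<partial>\<nu>))"
proof -
  define X where "X = x + y"
  have x: "0 \<le> x" and X: "0 \<le> X" using xy by (auto simp: X_def)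
  \<comment> \<open>Clamping to [0, X] turns \<open>v \<mu>\<close> into a bounded continuous
    function on the line, as weak convergence requires, and leaves the values at the nodes
    unchanged.\<close>
  define cl where "cl t = max 0 (min t X)" for t
  have cl: "cl t \<in> {0..X}" and cl_id: "t \<in> {0..X} \<Longrightarrow> cl t = t" for t
    using X by (auto simp: cl_def)
  have cont: "continuous_on {0..} (v \<mu>)" for \<mu>
    using v by (simp add: radial_solution_def)
  have cont_cl: "continuous_on UNIV (\<lambda>t. v \<mu> (cl t))" for \<mu>
    using X unfolding cl_def
    by (intro continuous_on_compose2[OF cont] continuous_intros) auto
  define V where "V t = Re (v 0 t)" for t
  have V: "v 0 t = of_real (V t)" "1 \<le> V t" if "0 \<le> t" for t
    using radial_zero_ge_1[OF v \<eta> that] by (simp_all add: V_def)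
  have bnd: "\<exists>C. \<forall>t\<in>{0..X}. norm (v \<mu> t) \<le> C" for \<mu>
    using compact_imp_bounded[OF compact_continuous_image[OF continuous_on_subset[OF cont] compact_Icc]]
    by (force simp: bounded_iff)
  define u where "u j = approx (mesh j) \<eta>" for j
  define r where "r j k = Re (u j 0 k)" for j k
  have r: "u j 0 k = of_real (r j k)" "1 \<le> r j k" for j k
  proof -
    obtain q where "approx (mesh j) \<eta> 0 k = of_real q" "1 \<le> q"
      using approx_zero[OF mesh_pos \<eta>] by blast
    then show "u j 0 k = of_real (r j k)" "1 \<le> r j k" by (simp_all add: r_def u_def)
  qed
  define c where "c j k = log_concave_chain.lin_coeff (grid (mesh j)) (potential (mesh j) \<eta>) k (index y j) (index x j)" for j k
  have chain: "log_concave_chain (grid (mesh j)) (potential (mesh j) \<eta>)" for j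
    by (rule grid_chain[OF mesh_pos \<eta>])
  have c_nonneg: "0 \<le> c j k" for j k
    unfolding c_def by (rule log_concave_chain.lin_coeff_nonneg[OF chain index_mono[OF xy(2)]])
  define N where "N j = index x j + index y j" for j
  have lin: "u j \<mu> (index x j) * u j \<mu> (index y j) = (\<Sum>k\<le>N j. of_real (c j k) * u j \<mu> k)" for j \<mu>
    unfolding u_def approx_def c_def N_def by (rule log_concave_chain.linearization[OF chain order_refl])
  \<comment> \<open>Linearization at \<open>\<mu> = 0\<close> shows that \<open>R j\<close> is the
    sum of the weights \<open>c j k * r j k\<close>, so dividing by it gives probabilities.\<close>
  define R where "R j = r j (index x j) * r j (index y j)" for j
  have R: "0 < R j" for j
    using r(2)[of j] by (auto simp: R_def intro!: mult_pos_pos intro: less_le_trans[OF zero_less_one])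
  define p where "p j k = c j k * r j k / R j" for j k
  have p_nonneg: "0 \<le> p j k" for j k
    using c_nonneg[of j k] r(2)[of j k] R[of j] by (simp add: p_def)
  have p_sum: "(\<Sum>k\<le>N j. p j k) = 1" for j
  proof -
    have "(of_real (R j) :: complex) = of_real (\<Sum>k\<le>N j. c j k * r j k)"
      using lin[of j 0] by (simp add: r R_def)
    then have "R j = (\<Sum>k\<le>N j. c j k * r j k)" by (simp only: of_real_eq_iff)
    then show ?thesis using R[of j] by (simp add: p_def flip: sum_divide_distrib)
  qed
  define t where "t j k = real k * mesh j" for j k
  have t: "t j k \<in> {0..X}" if "k \<le> N j" for j k
  proof -
    have "t j k \<le> real (N j) * mesh j"
      using that mesh_pos[of j] by (auto simp: t_def intro!: mult_right_mono)
    also have "\<dots> \<le> X"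
      using index_bounds(1)[OF x, of j] index_bounds(1)[OF xy(1), of j]
      by (simp add: N_def X_def algebra_simps)
    finally show ?thesis using mesh_pos[of j] by (simp add: t_def)
  qed
  have "\<exists>M s. real_distribution M \<and> strict_mono (s :: nat \<Rightarrow> nat) \<and>
    (\<forall>(f :: real \<Rightarrow> complex) B. (\<forall>x. isCont f x) \<longrightarrow> (\<forall>x. norm (f x) \<le> B) \<longrightarrow>
      (\<lambda>j. \<Sum>k\<le>N (s j). of_real (p (s j) k) * f (t (s j) k)) \<longlonglongrightarrow> integral\<^sup>L M f)"
    by (rule discrete_weak_limit[OF p_nonneg p_sum t])
  then obtain M s where M: "real_distribution M" and s: "strict_mono (s :: nat \<Rightarrow> nat)"
    and lim: "\<And>(f :: real \<Rightarrow> complex) B. (\<forall>x. isCont f x) \<Longrightarrow> (\<forall>x. norm (f x) \<le> B) \<Longrightarrow>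
      (\<lambda>j. \<Sum>k\<le>N (s j). of_real (p (s j) k) * f (t (s j) k)) \<longlonglongrightarrow> integral\<^sup>L M f"
    by blast
  interpret M: real_distribution M by (rule M)
  define f where "f \<mu> z = v \<mu> (cl z) / v 0 (cl z)" for \<mu> z
  have v0: "v 0 (cl z) \<noteq> 0" for z
    using V[of "cl z"] cl[of z] by auto
  have f_cont: "continuous_on UNIV (f \<mu>)" for \<mu>
    unfolding f_def[abs_def] by (intro continuous_on_divide cont_cl) (use v0 in auto)
  have f_isCont: "isCont (f \<mu>) z" for \<mu> z
    using f_cont[of \<mu>] by (simp add: continuous_on_eq_continuous_at)
  have f_le: "norm (f \<mu> z) \<le> norm (v \<mu> (cl z))" for \<mu> z
  proof -
    have "norm (v \<mu> (cl z)) * 1 \<le> norm (v \<mu> (cl z)) * V (cl z)"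
      using V[of "cl z"] cl[of z] by (intro mult_left_mono) auto
    then show ?thesis
      using V[of "cl z"] cl[of z] by (simp add: f_def norm_divide pos_divide_le_eq)
  qed
  have integral: "integral\<^sup>L M (f \<mu>) = v \<mu> x * v \<mu> y / (v 0 x * v 0 y)" for \<mu>
  proof -
    obtain C where C: "\<And>t. t \<in> {0..X} \<Longrightarrow> norm (v \<mu> t) \<le> C" using bnd[of \<mu>] by blast
    have C0: "0 \<le> C" using order_trans[OF norm_ge_zero C[of 0]] X by simp
    have "(\<lambda>j. u j \<mu> (index x j) * u j \<mu> (index y j) / (u j 0 (index x j) * u j 0 (index y j)))
        \<longlonglongrightarrow> v \<mu> x * v \<mu> y / (v 0 x * v 0 y)"
      unfolding u_def using V[of x] V[of y] x xy
      by (intro tendsto_divide tendsto_mult approx_limit v \<eta>) auto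
    moreover have "u j \<mu> (index x j) * u j \<mu> (index y j) / (u j 0 (index x j) * u j 0 (index y j))
        = (\<Sum>k\<le>N j. of_real (p j k) * (u j \<mu> k / u j 0 k))" for j
    proof -
      have "(\<Sum>k\<le>N j. of_real (p j k) * (u j \<mu> k / u j 0 k)) = (\<Sum>k\<le>N j. of_real (c j k) * u j \<mu> k / of_real (R j))"
      proof (rule sum.cong)
        fix k
        have "r j k \<noteq> 0" using r(2)[of j k] by auto
        then show "of_real (p j k) * (u j \<mu> k / u j 0 k) = of_real (c j k) * u j \<mu> k / of_real (R j)"
          by (simp add: p_def r)
      qed simp
      then show ?thesis
        by (simp add: lin[of j \<mu>] r R_def sum_divide_distrib)
    qed
    ultimately have 1: "(\<lambda>j. \<Sum>k\<le>N j. of_real (p j k) * (u j \<mu> k / u j 0 k))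
        \<longlonglongrightarrow> v \<mu> x * v \<mu> y / (v 0 x * v 0 y)" by simp
    \<comment> \<open>The discrete quotients are replaced by \<open>f \<mu>\<close> at the nodes;
      the error is uniform over the nodes and survives averaging with total weight 1.\<close>
    have 2: "(\<lambda>j. (\<Sum>k\<le>N j. of_real (p j k) * f \<mu> (t j k))
        - (\<Sum>k\<le>N j. of_real (p j k) * (u j \<mu> k / u j 0 k))) \<longlonglongrightarrow> 0"
    proof (rule tendstoI)
      fix \<epsilon> :: real assume "0 < \<epsilon>"
      \<comment> \<open>With 2 rather than 1 in the denominator, \<open>e + C * e\<close> falls
        short of \<open>\<epsilon>\<close> by \<open>e\<close>, which gives a strict
        inequality.\<close>
      define e where "e = \<epsilon> / (2 + C)"
      have "0 < e" "(2 + C) * e = \<epsilon>" using \<open>0 < \<epsilon>\<close> C0 by (auto simp: e_def)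
      then have e: "0 < e" "e + C * e < \<epsilon>" by (auto simp: distrib_right)
      have "\<forall>\<^sub>F j in sequentially. \<forall>k. real k * mesh j \<le> X \<longrightarrow> norm (v \<nu> (real k * mesh j) - u j \<nu> k) < e" for \<nu>
        using filterlim_iff[THEN iffD1, OF mesh_limit, rule_format, OF approx_uniform_limit[OF v \<eta> X e(1), of \<nu>]]
        by (simp add: u_def)
      from this[of \<mu>] this[of 0]
      show "\<forall>\<^sub>F j in sequentially. dist ((\<Sum>k\<le>N j. of_real (p j k) * f \<mu> (t j k))
        - (\<Sum>k\<le>N j. of_real (p j k) * (u j \<mu> k / u j 0 k))) 0 < \<epsilon>"
      proof eventually_elim
        case (elim j)
        have "norm (f \<mu> (t j k) - u j \<mu> k / u j 0 k) \<le> e + C * e" if k: "k \<le> N j" for k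
        proof -
          let ?t = "t j k"
          have tt: "?t \<in> {0..X}" using t k by blast
          then have d: "norm (v \<mu> ?t - u j \<mu> k) < e" "norm (v 0 ?t - u j 0 k) < e"
            using elim by (auto simp: t_def)
          have n: "1 \<le> norm (v 0 ?t)" "1 \<le> norm (u j 0 k)" "v 0 ?t \<noteq> 0" "u j 0 k \<noteq> 0"
            using V[of ?t] r[of j k] tt by auto
          have "f \<mu> ?t - u j \<mu> k / u j 0 k =
              (v \<mu> ?t - u j \<mu> k) / u j 0 k - v \<mu> ?t * (v 0 ?t - u j 0 k) / (v 0 ?t * u j 0 k)"
            using n by (simp add: f_def cl_id[OF tt] field_simps)
          also have "norm \<dots> \<le> norm (v \<mu> ?t - u j \<mu> k) / norm (u j 0 k)
              + norm (v \<mu> ?t) * norm (v 0 ?t - u j 0 k) / (norm (v 0 ?t) * norm (u j 0 k))"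
            by (rule order_trans[OF norm_triangle_ineq4]) (simp add: norm_divide norm_mult)
          also have "\<dots> \<le> e / 1 + C * e / (1 * 1)"
            using n d C[OF tt] C0 e(1)
            by (intro add_mono frac_le mult_mono) auto
          finally show ?thesis by simp
        qed
        then have "norm (\<Sum>k\<le>N j. of_real (p j k) * (f \<mu> (t j k) - u j \<mu> k / u j 0 k))
            \<le> (\<Sum>k\<le>N j. p j k * (e + C * e))"
          using p_nonneg by (intro sum_norm_le) (auto simp: norm_mult intro!: mult_left_mono)
        also have "\<dots> = e + C * e"
          using p_sum[of j] by (simp flip: sum_distrib_right)
        finally show ?case
          using e(2) by (simp add: right_diff_distrib sum_subtractf)
      qed
    qed
    have "(\<lambda>j. \<Sum>k\<le>N j. of_real (p j k) * f \<mu> (t j k)) \<longlonglongrightarrow> v \<mu> x * v \<mu> y / (v 0 x * v 0 y)"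
      using tendsto_add[OF 2 1] by simp
    from LIMSEQ_subseq_LIMSEQ[OF this s]
    have "(\<lambda>j. \<Sum>k\<le>N (s j). of_real (p (s j) k) * f \<mu> (t (s j) k)) \<longlonglongrightarrow> v \<mu> x * v \<mu> y / (v 0 x * v 0 y)"
      by (simp add: o_def)
    moreover have "\<forall>z. norm (f \<mu> z) \<le> C"
      using f_le C[OF cl] by (meson order_trans)
    ultimately show ?thesis
      using lim[of "f \<mu>"] f_isCont LIMSEQ_unique by blast
  qed
  \<comment> \<open>The density that undoes the normalisation by \<open>v 0\<close>; it is bounded
    because \<open>V\<close> is at least 1.\<close>
  define \<omega> where "\<omega> z = V x * V y / V (cl z)" for z
  have \<omega>: "0 \<le> \<omega> z" "\<omega> z \<le> V x * V y" for z
  proof -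
    have "1 \<le> V (cl z)" "1 \<le> V x" "1 \<le> V y" using V cl[of z] x xy by auto
    then show "0 \<le> \<omega> z" "\<omega> z \<le> V x * V y"
      unfolding \<omega>_def by (auto simp: divide_le_eq intro!: mult_left_mono[of 1 "V (cl z)" "V x * V y", simplified])
  qed
  have "continuous_on UNIV \<omega>"
    unfolding \<omega>_def V_def using V cl
    by (intro continuous_intros cont_cl ballI) (auto simp: V_def, metis Re_complex_of_real atLeastAtMost_iff not_one_le_zero)
  then have \<omega>_meas [measurable]: "\<omega> \<in> borel_measurable borel" by (rule borel_measurable_continuous_onI)
  have "continuous_on UNIV cl" unfolding cl_def by (intro continuous_intros)
  then have cl_meas: "cl \<in> measurable (density M (\<lambda>z. ennreal (\<omega> z))) (restrict_space borel {0..})"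
    using cl by (intro measurable_restrict_space2) (auto dest: borel_measurable_continuous_onI)
  \<comment> \<open>Since \<open>f \<mu> z\<close> and \<open>\<omega> z\<close> depend on
    \<open>z\<close> only through \<open>cl z\<close>, transport by \<open>cl\<close> keeps the
    integrals and puts the measure on the half-line.\<close>
  define \<nu> where "\<nu> = distr (density M (\<lambda>z. ennreal (\<omega> z))) (restrict_space borel {0..}) cl"
  have "finite_measure (density M (\<lambda>z. ennreal (\<omega> z)))"
  proof
    have "emeasure (density M (\<lambda>z. ennreal (\<omega> z))) (space (density M (\<lambda>z. ennreal (\<omega> z))))
        = (\<integral>\<^sup>+z. ennreal (\<omega> z) \<partial>M)"
      using emeasure_density[of "\<lambda>z. ennreal (\<omega> z)" M UNIV] by simp
    also have "\<dots> \<le> (\<integral>\<^sup>+z. ennreal (V x * V y) \<partial>M)"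
      using \<omega> by (intro nn_integral_mono ennreal_leI) auto
    also have "\<dots> < \<infinity>" by (simp add: M.emeasure_space_1[simplified])
    finally show "emeasure (density M (\<lambda>z. ennreal (\<omega> z))) (space (density M (\<lambda>z. ennreal (\<omega> z)))) \<noteq> \<infinity>"
      by simp
  qed
  then have "finite_measure \<nu>"
    unfolding \<nu>_def by (rule finite_measure.finite_measure_distr[OF _ cl_meas])
  moreover have "integrable \<nu> (v \<mu>) \<and> v \<mu> x * v \<mu> y = (\<integral>t. v \<mu> t \<partial>\<nu>)" for \<mu>
  proof -
    have vm: "v \<mu> \<in> borel_measurable (restrict_space borel {0..})"
      by (rule borel_measurable_continuous_on_restrict[OF cont])
    have vclm: "(\<lambda>z. v \<mu> (cl z)) \<in> borel_measurable M"
      using borel_measurable_continuous_onI[OF cont_cl[of \<mu>]] by simp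
    have eq: "\<omega> z *\<^sub>R v \<mu> (cl z) = (v 0 x * v 0 y) * f \<mu> z" for z
      using V[of x] V[of y] V[of "cl z"] cl[of z] x xy
      by (simp add: f_def \<omega>_def scaleR_conv_of_real)
    obtain C where "\<And>t. t \<in> {0..X} \<Longrightarrow> norm (v \<mu> t) \<le> C" using bnd[of \<mu>] by blast
    then have "norm (f \<mu> z) \<le> C" for z using f_le[of \<mu> z] cl[of z] by (meson order_trans)
    moreover have "f \<mu> \<in> borel_measurable M"
      using borel_measurable_continuous_onI[OF f_cont[of \<mu>]] by simp
    ultimately have "integrable M (f \<mu>)"
      by (intro M.integrable_const_bound[of _ C]) auto
    then have "integrable M (\<lambda>z. \<omega> z *\<^sub>R v \<mu> (cl z))"
      unfolding eq by (intro integrable_mult_right)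
    then have "integrable \<nu> (v \<mu>)"
      unfolding \<nu>_def integrable_distr_eq[OF cl_meas vm]
      using \<omega>(1) vclm by (subst integrable_density) auto
    moreover have "(\<integral>t. v \<mu> t \<partial>\<nu>) = (\<integral>z. \<omega> z *\<^sub>R v \<mu> (cl z) \<partial>M)"
      unfolding \<nu>_def integral_distr[OF cl_meas vm]
      using \<omega>(1) vclm by (intro integral_density) auto
    moreover have "\<dots> = (v 0 x * v 0 y) * integral\<^sup>L M (f \<mu>)"
      unfolding eq by simp
    moreover have "\<dots> = v \<mu> x * v \<mu> y"
      unfolding integral using V[of x] V[of y] x xy by auto
    ultimately show ?thesis by simp
  qed
  moreover have "sets \<nu> = sets (restrict_space borel {0..})" by (simp add: \<nu>_def)
  ultimately show ?thesis by blast
qed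

lemma radial_product_formula:
  assumes v: "\<And>\<mu>. radial_solution A \<mu> \<eta> (v \<mu>)" and \<eta>: "0 \<le> \<eta>" and "0 \<le> x" "0 \<le> y"
  obtains \<nu> where "sets \<nu> = sets (restrict_space borel {0..})" "finite_measure \<nu>"
    "\<And>\<mu>. integrable \<nu> (v \<mu>)" "\<And>\<mu>. v \<mu> x * v \<mu> y = (\<integral>t. v \<mu> t \<partial>\<nu>)"
proof (cases "y \<le> x")
  case True
  then show thesis using radial_product_formula_ordered[OF v \<eta>, of y x] assms that by blast
next
  case False
  then show thesis using radial_product_formula_ordered[OF v \<eta>, of x y] assms that
    by (metis mult.commute linear)
qed

end

section \<open>Product with the angular factor\<close>

text \<open>Fubini factorises the integral over the product measure. Transport by the identity only
  changes the sigma-algebra, from the product one to the Borel sets of the product space.\<close>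

lemma product_representation:
  fixes f :: "real \<Rightarrow> complex" and g :: "ereal \<Rightarrow> real"
  assumes fin: "finite_measure \<nu>" "finite_measure \<rho>"
    and sets: "sets \<nu> = sets (restrict_space borel {0..})" "sets \<rho> = sets (restrict_space borel I)"
    and int: "integrable \<nu> f" "integrable \<rho> g"
  defines "\<gamma> \<equiv> distr (\<nu> \<Otimes>\<^sub>M \<rho>) (restrict_space borel ({0..} \<times> I)) id"
  shows "integrable \<gamma> (\<lambda>\<xi>. of_real (g (snd \<xi>)) * f (fst \<xi>))" (is "integrable _ ?h")
    and "(\<integral>\<xi>. of_real (g (snd \<xi>)) * f (fst \<xi>) \<partial>\<gamma>) = of_real (\<integral>z. g z \<partial>\<rho>) * (\<integral>t. f t \<partial>\<nu>)"
proof -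
  interpret \<nu>: finite_measure \<nu> by (rule fin)
  interpret \<rho>: finite_measure \<rho> by (rule fin)
  interpret P: pair_sigma_finite \<nu> \<rho> ..
  have sp: "space \<nu> = {0..}" "space \<rho> = I"
    using sets_eq_imp_space_eq[OF sets(1)] sets_eq_imp_space_eq[OF sets(2)]
    by (auto simp: space_restrict_space)
  have f [measurable]: "f \<in> borel_measurable \<nu>" and g [measurable]: "g \<in> borel_measurable \<rho>"
    using int by auto
  have cid: "(\<lambda>t. t) \<in> borel_measurable \<nu>" "(\<lambda>z. z) \<in> borel_measurable \<rho>"
    unfolding measurable_cong_sets[OF sets(1) refl] measurable_cong_sets[OF sets(2) refl]
    by (auto intro: measurable_restrict_space1)
  have "(\<lambda>\<xi>. (fst \<xi>, snd \<xi>)) \<in> borel_measurable (\<nu> \<Otimes>\<^sub>M \<rho>)"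
    by (intro borel_measurable_Pair measurable_compose[OF measurable_fst cid(1)]
        measurable_compose[OF measurable_snd cid(2)])
  then have idm: "id \<in> measurable (\<nu> \<Otimes>\<^sub>M \<rho>) (restrict_space borel ({0..} \<times> I))"
    by (intro measurable_restrict_space2) (auto simp: space_pair_measure sp id_def)
  have hint: "integrable (\<nu> \<Otimes>\<^sub>M \<rho>) ?h"
  proof (rule P.Fubini_integrable)
    show "?h \<in> borel_measurable (\<nu> \<Otimes>\<^sub>M \<rho>)" by measurable
    have "(\<integral>z. norm (of_real (g (snd (t, z))) * f (fst (t, z))) \<partial>\<rho>) = (\<integral>z. \<bar>g z\<bar> \<partial>\<rho>) * norm (f t)" for t
      by (simp add: norm_mult)
    then show "integrable \<nu> (\<lambda>t. \<integral>z. norm (of_real (g (snd (t, z))) * f (fst (t, z))) \<partial>\<rho>)"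
      using int by simp
    show "AE t in \<nu>. integrable \<rho> (\<lambda>z. of_real (g (snd (t, z))) * f (fst (t, z)))"
      using int by simp
  qed
  have hm: "?h \<in> borel_measurable (restrict_space borel ({0..} \<times> I))"
  proof -
    have "f \<in> borel_measurable (restrict_space borel {0..})" "g \<in> borel_measurable (restrict_space borel I)"
      using f g measurable_cong_sets[OF sets(1) refl] measurable_cong_sets[OF sets(2) refl] by blast+
    moreover have "fst \<in> borel_measurable (borel :: (real \<times> ereal) measure)"
      "snd \<in> borel_measurable (borel :: (real \<times> ereal) measure)"
      by (intro borel_measurable_continuous_onI continuous_intros)+
    then have "fst \<in> measurable (restrict_space borel ({0::real..} \<times> I)) (restrict_space borel {0..})"
      "snd \<in> measurable (restrict_space borel ({0::real..} \<times> I)) (restrict_space borel I)"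
      by (auto intro: measurable_restrict_space2[OF _ measurable_restrict_space1]
          simp: space_restrict_space)
    ultimately show ?thesis
      by (intro borel_measurable_times borel_measurable_of_real) (auto intro: measurable_compose)
  qed
  show "integrable \<gamma> ?h"
    unfolding \<gamma>_def integrable_distr_eq[OF idm hm] using hint by simp
  have "integral\<^sup>L \<gamma> ?h = integral\<^sup>L (\<nu> \<Otimes>\<^sub>M \<rho>) ?h"
    unfolding \<gamma>_def integral_distr[OF idm hm] by simp
  also have "\<dots> = (\<integral>t. (\<integral>z. of_real (g z) * f t \<partial>\<rho>) \<partial>\<nu>)"
    using P.integral_fst'[OF hint] by simp
  also have "\<dots> = of_real (\<integral>z. g z \<partial>\<rho>) * (\<integral>t. f t \<partial>\<nu>)"
    by simp
  finally show "integral\<^sup>L \<gamma> ?h = of_real (\<integral>z. g z \<partial>\<rho>) * (\<integral>t. f t \<partial>\<nu>)" .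
qed

theorem proposition6p2:
  fixes A p r :: "real \<Rightarrow> real"
    and a b :: ereal
    and \<psi> :: "real \<Rightarrow> real \<Rightarrow> real"
    and \<sigma> :: "real measure"
    and v :: "complex \<Rightarrow> real \<Rightarrow> real \<Rightarrow> complex"
    and \<pi> :: "ereal \<Rightarrow> ereal \<Rightarrow> ereal measure"
  defines "I \<equiv> state_interval p r a b"
    and "M \<equiv> state_space p r a b"
    and "\<psi>I \<equiv> (\<lambda>\<eta>. endpoint_ext a b (\<psi> \<eta>))"
    and "w \<equiv> separable_solution a b \<psi> v"
  assumes A: "cone_function A"
    and ab: "a < b"
    and p_ac: "loc_abs_cont a b p" and p_pos: "\<forall>z\<in>einterval a b. p z > 0"
    and r_ac: "loc_abs_cont a b r" and r_pos: "\<forall>z\<in>einterval a b. r z > 0"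
    and a_type: "regular_left p r a b \<or> entrance_left p r a b"
    and psi: "\<forall>\<eta>\<ge>0. Neumann_solution p r a b \<eta> (\<psi> \<eta>)"
    and sigma: "spectral_measure p r a b \<psi> \<sigma>"
    and v: "\<forall>\<mu>. \<forall>\<eta>\<ge>0. radial_solution A \<mu> \<eta> (v \<mu> \<eta>)"
    and pi_prob: "\<forall>z1\<in>I. \<forall>z2\<in>I. prob_space (\<pi> z1 z2) \<and>
          sets (\<pi> z1 z2) = sets (restrict_space borel I)"
    and pi_product: "\<forall>z1\<in>I. \<forall>z2\<in>I. \<forall>\<eta>\<in>msupport \<sigma>.
          integrable (\<pi> z1 z2) (\<psi>I \<eta>) \<and>
          \<psi>I \<eta> z1 * \<psi>I \<eta> z2 = (\<integral>z3. \<psi>I \<eta> z3 \<partial>\<pi> z1 z2)"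
  shows "\<forall>\<eta>\<in>msupport \<sigma>. \<forall>\<xi>1\<in>M. \<forall>\<xi>2\<in>M.
          \<exists>\<gamma> :: (real \<times> ereal) measure.
            sets \<gamma> = sets (restrict_space borel M) \<and>
            (\<forall>\<mu>. integrable \<gamma> (w \<mu> \<eta>) \<and>
                 w \<mu> \<eta> \<xi>1 * w \<mu> \<eta> \<xi>2 = (\<integral>\<xi>3. w \<mu> \<eta> \<xi>3 \<partial>\<gamma>))"
proof (intro ballI)
  fix \<eta> \<xi>1 \<xi>2 assume \<eta>: "\<eta> \<in> msupport \<sigma>" and \<xi>: "\<xi>1 \<in> M" "\<xi>2 \<in> M"
  obtain x1 z1 x2 z2 where xz: "\<xi>1 = (x1, z1)" "\<xi>2 = (x2, z2)" "0 \<le> x1" "0 \<le> x2" "z1 \<in> I" "z2 \<in> I"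
    using \<xi> by (cases \<xi>1; cases \<xi>2) (auto simp: M_def I_def state_space_def)
  \<comment> \<open>Points of the support lie in the space of \<open>\<sigma>\<close>, which yields
    the sign of \<open>\<eta>\<close> needed for the radial formula.\<close>
  have "space \<sigma> = {0..}"
    using sigma sets_eq_imp_space_eq[of \<sigma> "restrict_space borel {0..}"]
    by (auto simp: spectral_measure_def space_restrict_space)
  then have "0 \<le> \<eta>" using \<eta> by (auto simp: msupport_def)
  interpret cone A by unfold_locales (rule A)
  obtain \<nu> where \<nu>: "sets \<nu> = sets (restrict_space borel {0..})" "finite_measure \<nu>"
    "\<And>\<mu>. integrable \<nu> (v \<mu> \<eta>)" "\<And>\<mu>. v \<mu> \<eta> x1 * v \<mu> \<eta> x2 = (\<integral>t. v \<mu> \<eta> t \<partial>\<nu>)"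
    using radial_product_formula[of \<eta> "\<lambda>\<mu>. v \<mu> \<eta>" x1 x2] v \<open>0 \<le> \<eta>\<close> xz by blast
  let ?\<rho> = "\<pi> z1 z2"
  \<comment> \<open>Neither factor involves \<open>\<mu>\<close>, so the measure is the same for
    every spectral parameter.\<close>
  let ?\<gamma> = "distr (\<nu> \<Otimes>\<^sub>M ?\<rho>) (restrict_space borel ({0..} \<times> I)) id"
  have \<rho>: "finite_measure ?\<rho>" "sets ?\<rho> = sets (restrict_space borel I)"
    using pi_prob xz by (auto simp: prob_space_def)
  have \<psi>: "integrable ?\<rho> (\<psi>I \<eta>)" "\<psi>I \<eta> z1 * \<psi>I \<eta> z2 = (\<integral>z. \<psi>I \<eta> z \<partial>?\<rho>)"
    using pi_product xz \<eta> by auto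
  have w: "w \<mu> \<eta> = (\<lambda>\<xi>. of_real (\<psi>I \<eta> (snd \<xi>)) * v \<mu> \<eta> (fst \<xi>))" for \<mu>
    by (simp add: w_def \<psi>I_def separable_solution_def fun_eq_iff)
  note rep = product_representation[OF \<nu>(2) \<rho>(1) \<nu>(1) \<rho>(2) \<nu>(3) \<psi>(1)]
  have "w \<mu> \<eta> \<xi>1 * w \<mu> \<eta> \<xi>2 = (\<integral>\<xi>. w \<mu> \<eta> \<xi> \<partial>?\<gamma>)" for \<mu>
  proof -
    have "w \<mu> \<eta> \<xi>1 * w \<mu> \<eta> \<xi>2 = of_real (\<psi>I \<eta> z1 * \<psi>I \<eta> z2) * (v \<mu> \<eta> x1 * v \<mu> \<eta> x2)"
      by (simp add: w xz)
    also have "\<dots> = (\<integral>\<xi>. w \<mu> \<eta> \<xi> \<partial>?\<gamma>)"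
      unfolding w rep(2) \<psi>(2) \<nu>(4) ..
    finally show ?thesis .
  qed
  moreover have "integrable ?\<gamma> (w \<mu> \<eta>)" for \<mu>
    unfolding w by (rule rep(1))
  moreover have "sets ?\<gamma> = sets (restrict_space borel M)"
    by (simp add: M_def I_def state_space_def)
  ultimately show "\<exists>\<gamma> :: (real \<times> ereal) measure.
            sets \<gamma> = sets (restrict_space borel M) \<and>
            (\<forall>\<mu>. integrable \<gamma> (w \<mu> \<eta>) \<and>
                 w \<mu> \<eta> \<xi>1 * w \<mu> \<eta> \<xi>2 = (\<integral>\<xi>3. w \<mu> \<eta> \<xi>3 \<partial>\<gamma>))"
    by blast
qed

end
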